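(* Let $\mu$ be a probability distribution on $\mathbb{N}$. (1) If $\mu$ is of finite type and $(\mu(n),n\ge1)$ is non-increasing, then, for any initial locally finite configuration $X_0\in\mathcal{S}$, the infinite-bin model with reproduction law $\mu$ started from $X_0$ satisfies $X_\infty(k)<\infty$ almost surely, for all $k\in\mathbb{Z}$. (2) If $\mu$ is of infinite type, then there exists a locally finite configuration $X_0\in\mathcal{S}$ such that the infinite-bin model with reproduction law $\mu$ started from $X_0$ satisfies $X_\infty(k)=\infty$ almost surely, for all $k\in\mathbb{Z}$.
   Context: $\mathbb{N}=\{1,2,\ldots\}$ and $\mathbb{Z}_+=\{0,1,2,\ldots\}$. The set of configurations is $$\mathcal{S}=\Big\{X:\mathbb{Z}\to\mathbb{Z}_+\cup\{\infty\}\ :\ \sup\{j\in\mathbb{Z}: X(j)\neq 0\}\in(-\infty,\infty)\Big\};$$ $X(j)$ is the number of balls in the bin at position $j$ (so a configuration has at least one ball, and bins far enough to the right are empty). A configuration $X\in\mathcal{S}$ is locally finite if $X(k)<\infty$ for all $k\in\mathbb{Z}$. For $X\in\mathcal{S}$ and $k\in\mathbb{N}$, let $B(X,k)=\sup\{j\in\mathbb{Z}:\sum_{i=j}^\infty X(i)\ge k\}$ (location of the $k$th rightmost ball), with $\sup\emptyset=-\infty$. For $\xi\in\mathbb{N}$ define $\Phi_\xi:\mathcal{S}\to\mathcal{S}$ by $\Phi_\xi(X)(j)=X(j)+\mathbf{1}_{\{j=B(X,\xi)+1\}}$ for all $j\in\mathbb{Z}$ if $B(X,\xi)>-\infty$,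 and $\Phi_\xi(X)=X$ otherwise. Given a probability distribution $\mu$ on $\mathbb{N}$ and $X_0\in\mathcal{S}$ (deterministic), the infinite-bin model (IBM) with reproduction law $\mu$ started from $X_0$ is the process defined by $X_{n+1}=\Phi_{\xi_{n+1}}(X_n)$, $n\ge 0$, where $(\xi_n)_{n\ge1}$ are i.i.d. with law $\mu$. Since $X_n(k)$ is non-decreasing in $n$, the limit $X_\infty(k)=\lim_{n\to\infty}X_n(k)\in\mathbb{Z}_+\cup\{\infty\}$ exists for every $k\in\mathbb{Z}$. $(\widehat{X}_n)_{n\ge0}$ denotes the IBM with reproduction law $\mu$ started from the configuration $\widehat{X}_0$ with $\widehat{X}_0(0)=\infty$ and $\widehat{X}_0(k)=0$ for $k\ne0$. For a deterministic $d\in\mathbb{N}\cup\{\infty\}$, $\mu$ is said to be of type $d$ if $d=\inf\{k\ge1:\widehat{X}_\infty(k)<+\infty\}$ almost surely (with $\inf\emptyset=\infty$). $\mu$ is of finite type if it is of type $d$ for some $d<\infty$, and of infinite type if it is of type $d=\infty$. *)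

theory Defs
  imports "HOL-Probability.Probability"
begin

type_synonym config = "int \<Rightarrow> enat"

definition configs :: "config set" where
  "configs = {X. -\<infinity> < (SUP j\<in>{j. X j \<noteq> 0}. ereal (of_int j)) \<and>
                 (SUP j\<in>{j. X j \<noteq> 0}. ereal (of_int j)) < \<infinity>}"

definition locally_finite :: "config \<Rightarrow> bool" where
  "locally_finite X \<longleftrightarrow> (\<forall>k. X k < \<infinity>)"

text \<open>The location of the \<open>k\<close>-th rightmost ball is an extended real, so that the supremum of the
  empty set is \<open>-\<infinity>\<close>.\<close>

definition ball_pos :: "config \<Rightarrow> nat \<Rightarrow> ereal" where
  "ball_pos X k = (SUP j\<in>{j. enat k \<le> (\<Sum>\<^sub>\<infinity>i\<in>{j..}. X i)}. ereal (of_int j))"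

definition ibm_move :: "nat \<Rightarrow> config \<Rightarrow> config" where
  "ibm_move k X =
     (if ball_pos X k > -\<infinity>
      then (\<lambda>j. X j + (if ereal (of_int j) = ball_pos X k + 1 then 1 else 0))
      else X)"

text \<open>The driving sequence is indexed from 0: \<open>\<xi> n\<close> is the number used in the step from time
  \<open>n\<close> to time \<open>n + 1\<close>.\<close>

primrec ibm :: "config \<Rightarrow> (nat \<Rightarrow> nat) \<Rightarrow> nat \<Rightarrow> config" where
  "ibm X0 \<xi> 0 = X0"
| "ibm X0 \<xi> (Suc n) = ibm_move (\<xi> n) (ibm X0 \<xi> n)"

text \<open>The limit is taken in the order topology of \<^typ>\<open>enat\<close>; it exists because the number of
  balls in a bin never decreases.\<close>

definition ibm_limit :: "config \<Rightarrow> (nat \<Rightarrow> nat) \<Rightarrow> config" where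
  "ibm_limit X0 \<xi> k = lim (\<lambda>n. ibm X0 \<xi> n k)"

definition iid_with_law :: "'a measure \<Rightarrow> (nat \<Rightarrow> 'a \<Rightarrow> nat) \<Rightarrow> nat pmf \<Rightarrow> bool" where
  "iid_with_law M \<xi> \<mu> \<longleftrightarrow>
     prob_space M \<and>
     prob_space.indep_vars M (\<lambda>_. count_space UNIV) \<xi> UNIV \<and>
     (\<forall>n. distr M (count_space UNIV) (\<xi> n) = measure_pmf \<mu>)"

definition hat_config :: config where
  "hat_config = (\<lambda>k. if k = 0 then \<infinity> else 0)"

text \<open>Being of type \<open>d\<close> depends only on the law of the driving sequence, so it is expressed on the
  canonical space of sequences with the product measure. The infimum is taken in \<^typ>\<open>enat\<close>, where
  the infimum of the empty set is \<open>\<infinity>\<close>.\<close>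

definition of_type :: "nat pmf \<Rightarrow> enat \<Rightarrow> bool" where
  "of_type \<mu> d \<longleftrightarrow>
     (AE \<xi> in (\<Pi>\<^sub>M n\<in>(UNIV :: nat set). measure_pmf \<mu>).
        d = (INF k\<in>{k. 1 \<le> k \<and> ibm_limit hat_config \<xi> (int k) < \<infinity>}. enat k))"

lemma iid_with_law_canonical:
  "iid_with_law (\<Pi>\<^sub>M n\<in>(UNIV :: nat set). measure_pmf \<mu>) (\<lambda>n \<xi>. \<xi> n) \<mu>"
proof -
  interpret P: product_prob_space "\<lambda>_. measure_pmf \<mu>" "UNIV :: nat set"
    by unfold_locales
  have ps: "prob_space (\<Pi>\<^sub>M n\<in>(UNIV :: nat set). measure_pmf \<mu>)"
    by (rule P.prob_space_axioms)
  have meas: "(\<lambda>\<xi>. \<xi> n) \<in> measurable (\<Pi>\<^sub>M n\<in>(UNIV :: nat set). measure_pmf \<mu>) (count_space UNIV)" for n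
    using measurable_component_singleton[of n UNIV "\<lambda>_. measure_pmf \<mu>"] by simp
  have law: "distr (\<Pi>\<^sub>M n\<in>(UNIV :: nat set). measure_pmf \<mu>) (count_space UNIV) (\<lambda>\<xi>. \<xi> n) = measure_pmf \<mu>" for n
  proof -
    have "distr (\<Pi>\<^sub>M n\<in>(UNIV :: nat set). measure_pmf \<mu>) (count_space UNIV) (\<lambda>\<xi>. \<xi> n)
        = distr (\<Pi>\<^sub>M n\<in>(UNIV :: nat set). measure_pmf \<mu>) (measure_pmf \<mu>) (\<lambda>\<xi>. \<xi> n)"
      by (rule distr_cong) auto
    also have "\<dots> = measure_pmf \<mu>"
      by (rule P.PiM_component) simp
    finally show ?thesis .
  qed
  have "sets (\<Pi>\<^sub>M n\<in>(UNIV :: nat set). measure_pmf \<mu>) = sets (\<Pi>\<^sub>M n\<in>(UNIV :: nat set). count_space UNIV)"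
    by (intro sets_PiM_cong) auto
  then have "P.indep_vars (\<lambda>_. count_space UNIV) (\<lambda>n \<xi>. \<xi> n) UNIV"
    by (subst P.indep_vars_iff_distr_eq_PiM') 
       (auto simp: meas law restrict_UNIV intro!: distr_id2[symmetric] distr_id2)
  with ps law show ?thesis unfolding iid_with_law_def by blast
qed

definition finite_type :: "nat pmf \<Rightarrow> bool" where
  "finite_type \<mu> \<longleftrightarrow> (\<exists>d::nat. 1 \<le> d \<and> of_type \<mu> (enat d))"

definition infinite_type :: "nat pmf \<Rightarrow> bool" where
  "infinite_type \<mu> \<longleftrightarrow> of_type \<mu> \<infinity>"

end

theory Submission
  imports Defs
begin

text \<open>
  Everything is read off the tails, that is, the numbers of balls in the bins \<open>k, k + 1, \<dots>\<close>. A move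
  \<open>x\<close> adds one ball to the tail of bin \<open>k\<close> exactly if \<open>x\<close> is at most the tail of bin \<open>k - 1\<close>, so the
  ball lands in bin \<open>k\<close> exactly if \<open>x\<close> falls into the gap between the tails of \<open>k\<close> and of \<open>k - 1\<close>,
  and a bin that starts finite ends infinite exactly if its gap is hit infinitely often.
  The moves may be taken to be the coordinates of the product space, where the next move is
  independent of the current tails.

  Two general facts are used throughout. First, when a tail passes through a value \<open>t\<close> that is not too small, it stays there
  for a geometric time of bounded mean; the expected number of moves that equal the current tail plus
  a constant \<open>c\<close> is therefore at most a constant times \<open>\<Sum>t. \<mu> (t + c) \<le> 1\<close>. So almost surely only
  finitely many moves fall into a window of fixed width just above a given tail that has become large
  (\<open>AE_finite_windows\<close>). Second, once some tail exceeds a value that most moves stay below, all later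
  tails grow linearly (\<open>tails_growth\<close>).

  Windows have two consequences. If a bin stays finite, the gap of the next bin has bounded
  width, so the next bin stays finite too (\<open>finite_gap_Suc\<close>). And if two processes have an infinite
  bin in common and are driven by the same moves, their tails stay boundedly far apart, so they have
  the same infinite bins, whatever finite number of balls they started with to the right
  (\<open>infinite_gap_transfer\<close>).

  For an infinite type, put \<open>a j\<close> balls into bin \<open>- j\<close> for all \<open>j\<close>, where \<open>a j\<close> is chosen after
  \<open>a 0, \<dots>, a (j - 1)\<close>. Replacing the pile in bin \<open>- j\<close> by an infinite bin gives a process in
  which every bin to the right of \<open>- j\<close> becomes infinite, so by some time \<open>T\<close> all bins in
  \<open>{- j<..<j}\<close> have received at least \<open>j\<close> balls. The pile is indistinguishable from an infinite bin up to
  time \<open>T\<close> if none of the moves so far exceeds \<open>a j\<close>, and \<open>a j\<close> can be chosen so large that this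
  fails with probability at most \<open>2 ^ (- j)\<close>. Borel--Cantelli finishes the argument
  (\<open>infinite_type_explosion\<close>).

  For a finite type and non-increasing \<open>\<mu>\<close>, the rate at which a bin is filled is, up to constant
  factors, the content of the preceding bin times \<open>\<mu> n\<close>, because the tails at time \<open>n\<close> are of
  order \<open>n\<close>. This suggests the deterministic recursion \<open>growth\<close>, whose level \<open>0\<close> sums the
  probabilities \<open>\<mu> {n<..}\<close> of a move beyond \<open>n\<close>. If all levels were unbounded, then in the process
  started from a single infinite bin every bin would be at least of the order of its level in
  probability, and the type would be infinite (\<open>finite_type_growth_bounded\<close>). So some level is bounded.
  Conversely, starting from any locally finite configuration with infinitely many balls, the expected content of the bins
  to the right of a bin with a large tail is bounded by constant multiples of the levels
  (\<open>expected_visits_le_profile\<close>, \<open>profile_half_time_le\<close>): expectations are enough here because the upper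
  bound on the rate is linear in the content of the preceding bin. Hence bins
  arbitrarily far to the left stay finite, and so do all bins after them. With finitely many balls, the
  bins to the left of all of them stay empty.
\<close>

section \<open>Tails and the bin hit by a move\<close>

definition tail :: "config \<Rightarrow> int \<Rightarrow> enat" where
  "tail X k = (\<Sum>\<^sub>\<infinity>i\<in>{k..}. X i)"

primrec tails :: "(int \<Rightarrow> enat) \<Rightarrow> (nat \<Rightarrow> nat) \<Rightarrow> nat \<Rightarrow> int \<Rightarrow> enat" where
  "tails a \<omega> 0 = a"
| "tails a \<omega> (Suc n) =
     (\<lambda>k. tails a \<omega> n k + of_bool (enat (\<omega> n) \<le> tails a \<omega> n (k - 1)))"

text \<open>The values of the move at time \<open>n\<close> that put a ball into bin \<open>k\<close>.\<close>

definition gap :: "(int \<Rightarrow> enat) \<Rightarrow> int \<Rightarrow> (nat \<Rightarrow> nat) \<Rightarrow> nat \<Rightarrow> nat set" where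
  "gap a k \<omega> n = {x. tails a \<omega> n k < enat x \<and> enat x \<le> tails a \<omega> n (k - 1)}"

text \<open>The family \<open>W\<close> may depend on the past of the moves; it will be a gap or a constant set. For a gap, the visits count
  the balls that a bin has received.\<close>

definition visits :: "((nat \<Rightarrow> nat) \<Rightarrow> nat \<Rightarrow> nat set) \<Rightarrow> (nat \<Rightarrow> nat) \<Rightarrow> nat \<Rightarrow> nat" where
  "visits W \<omega> n = card {i. i < n \<and> \<omega> i \<in> W \<omega> i}"

lemma visits_0 [simp]: "visits W \<omega> 0 = 0"
  by (simp add: visits_def)

lemma visits_Suc: "visits W \<omega> (Suc n) = visits W \<omega> n + of_bool (\<omega> n \<in> W \<omega> n)"
proof -
  have "{i. i < Suc n \<and> \<omega> i \<in> W \<omega> i} =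
      {i. i < n \<and> \<omega> i \<in> W \<omega> i} \<union> (if \<omega> n \<in> W \<omega> n then {n} else {})"
    by (auto simp: less_Suc_eq)
  then show ?thesis
    by (auto simp: visits_def)
qed

lemma visits_mono: "m \<le> n \<Longrightarrow> visits W \<omega> m \<le> visits W \<omega> n"
  unfolding visits_def by (rule card_mono) auto

lemma visits_le: "visits W \<omega> n \<le> n"
  by (induction n) (auto simp: visits_Suc)

lemma visits_le_card:
  "finite {i. \<omega> i \<in> W \<omega> i} \<Longrightarrow> visits W \<omega> n \<le> card {i. \<omega> i \<in> W \<omega> i}"
  unfolding visits_def by (rule card_mono) auto

lemma finite_visits_iff: "finite {i. \<omega> i \<in> W \<omega> i} \<longleftrightarrow> (\<exists>B. \<forall>n. visits W \<omega> n \<le> B)"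
proof
  assume "finite {i. \<omega> i \<in> W \<omega> i}"
  then show "\<exists>B. \<forall>n. visits W \<omega> n \<le> B"
    using visits_le_card by blast
next
  assume "\<exists>B. \<forall>n. visits W \<omega> n \<le> B"
  then obtain B where B: "\<And>n. visits W \<omega> n \<le> B" by blast
  show "finite {i. \<omega> i \<in> W \<omega> i}"
  proof (rule ccontr)
    assume "infinite {i. \<omega> i \<in> W \<omega> i}"
    then obtain S where S: "S \<subseteq> {i. \<omega> i \<in> W \<omega> i}" "finite S" "card S = Suc B"
      using infinite_arbitrarily_large by blast
    have "S \<subseteq> {i. i < Suc (Max S) \<and> \<omega> i \<in> W \<omega> i}"
      using S by (auto simp: less_Suc_eq_le)
    then have "card S \<le> visits W \<omega> (Suc (Max S))"
      unfolding visits_def by (rule card_mono[rotated]) auto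
    with B[of "Suc (Max S)"] S show False by simp
  qed
qed

lemma configs_right_bounded:
  assumes "X \<in> configs" obtains R where "\<forall>j>R. X j = 0"
proof -
  have "(SUP j\<in>{j. X j \<noteq> 0}. ereal (of_int j)) < \<infinity>"
    using assms by (simp add: configs_def)
  then have "\<exists>n::nat. (SUP j\<in>{j. X j \<noteq> 0}. ereal (of_int j)) < ereal (real n)"
    unfolding less_PInf_Ex_of_nat[symmetric] by simp
  then obtain r :: real where r: "(SUP j\<in>{j. X j \<noteq> 0}. ereal (of_int j)) < ereal r"
    by blast
  have "X j = 0" if "\<lceil>r\<rceil> < j" for j
  proof (rule ccontr)
    assume "X j \<noteq> 0"
    then have "ereal (of_int j) \<le> (SUP j\<in>{j. X j \<noteq> 0}. ereal (of_int j))"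
      by (intro SUP_upper) auto
    then have "ereal (of_int j) < ereal r" using r by (rule le_less_trans)
    then have "of_int j < r" by simp
    with that show False by linarith
  qed
  then show ?thesis using that by blast
qed

lemma tail_eq_sum:
  assumes "\<forall>j>R. X j = 0" shows "tail X k = sum X {k..R}"
proof -
  have "tail X k = infsum X {k..R}"
    unfolding tail_def using assms by (intro infsum_cong_neutral) auto
  then show ?thesis by simp
qed

lemma tail_rec:
  assumes "\<forall>j>R. X j = 0" shows "tail X k = X k + tail X (k + 1)"
proof (cases "k \<le> R")
  case True
  then have "{k..R} = insert k {k+1..R}" by auto
  then show ?thesis by (simp add: tail_eq_sum[OF assms])
next
  case False
  then show ?thesis using assms by (simp add: tail_eq_sum[OF assms])
qed

lemma antimono_tail:
  assumes "\<forall>j>R. X j = 0" shows "antimono (tail X)"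
proof (rule antimonoI)
  fix k l :: int assume "k \<le> l"
  then have "sum X {l..R} \<le> sum X {k..R}" by (intro sum_mono2) auto
  then show "tail X l \<le> tail X k" by (simp add: tail_eq_sum[OF assms])
qed

text \<open>The ball of rank \<open>m\<close> sits in the rightmost bin \<open>b\<close> whose tail still contains \<open>m\<close> balls, so
  the new ball arrives in the unique bin \<open>k\<close> with \<open>tail X k < m \<le> tail X (k - 1)\<close>.\<close>

lemma ibm_move_eq:
  assumes R: "\<forall>j>R. X j = 0" and m: "1 \<le> m"
  shows "ibm_move m X = (\<lambda>k. X k + of_bool (tail X k < enat m \<and> enat m \<le> tail X (k - 1)))"
proof (cases "{j. enat m \<le> tail X j} = {}")
  case True
  then have "ball_pos X m = -\<infinity>"
    unfolding ball_pos_def tail_def by (simp add: bot_ereal_def)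
  moreover have "\<not> enat m \<le> tail X j" for j using True by auto
  ultimately show ?thesis by (auto simp: ibm_move_def fun_eq_iff)
next
  case False
  let ?J = "{j. enat m \<le> tail X j}"
  have am: "antimono (tail X)" by (rule antimono_tail[OF R])
  have bd: "j \<le> R" if "j \<in> ?J" for j
  proof (rule ccontr)
    assume "\<not> j \<le> R"
    then have "tail X j = 0" by (subst tail_eq_sum[OF R]) auto
    with that m show False by (simp add: zero_enat_def)
  qed
  from False obtain j0 where j0: "j0 \<in> ?J" by blast
  define b where "b = Max (?J \<inter> {j0..R})"
  have fin: "finite (?J \<inter> {j0..R})" by simp
  have ne: "?J \<inter> {j0..R} \<noteq> {}" using j0 bd by auto
  have bJ: "b \<in> ?J" using Max_in[OF fin ne] unfolding b_def by blast
  have bmax: "j \<le> b" if "j \<in> ?J" for j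
  proof (cases "j0 \<le> j")
    case True
    then show ?thesis unfolding b_def using that bd by (intro Max_ge) auto
  next
    case False
    moreover have "j0 \<le> b" using Max_in[OF fin ne] unfolding b_def by auto
    ultimately show ?thesis by simp
  qed
  have iff: "enat m \<le> tail X j \<longleftrightarrow> j \<le> b" for j
    using bmax bJ antimonoD[OF am, of j b] by (auto intro: order_trans)
  have "ball_pos X m = (SUP j\<in>{..b}. ereal (of_int j))"
    unfolding ball_pos_def tail_def[symmetric] by (simp add: iff atMost_def)
  also have "\<dots> = ereal (of_int b)"
    by (intro antisym SUP_least SUP_upper) auto
  finally have pos: "ball_pos X m = ereal (of_int b)" .
  have [simp]: "tail X k < enat m \<longleftrightarrow> b < k" for k using iff[of k] by auto
  have "(ereal (of_int j) = ereal (of_int b) + 1) = (j = b + 1)" for j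
  proof -
    have "ereal (of_int b) + 1 = ereal (of_int (b + 1))" by simp
    then show ?thesis by (simp only: ereal.inject of_int_eq_iff)
  qed
  then show ?thesis
    unfolding ibm_move_def pos by (auto simp: iff fun_eq_iff)
qed

lemma tail_ibm_move:
  assumes R: "\<forall>j>R. X j = 0" and m: "1 \<le> m"
  shows "tail (ibm_move m X) k = tail X k + of_bool (enat m \<le> tail X (k - 1))"
proof -
  let ?Y = "ibm_move m X"
  have am: "antimono (tail X)" by (rule antimono_tail[OF R])
  have "tail X j = 0" if "R < j" for j by (simp add: tail_eq_sum[OF R] that)
  then have none: "\<not> enat m \<le> tail X j" if "R < j" for j
    using that m by (simp add: zero_enat_def)
  have R': "\<forall>j>R + 1. ?Y j = 0"
    using R none by (simp add: ibm_move_eq[OF R m])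
  have gen: "tail ?Y k = tail X k + of_bool (enat m \<le> tail X (k - 1))"
    if "int d = R + 2 - k \<or> R + 2 < k" for d
    using that
  proof (induction d arbitrary: k)
    case 0
    then have "R + 2 \<le> k" by auto
    then show ?case using none[of "k - 1"]
      by (simp add: tail_eq_sum[OF R'] tail_eq_sum[OF R])
  next
    case (Suc d)
    have IH: "tail ?Y (k + 1) = tail X (k + 1) + of_bool (enat m \<le> tail X k)"
      using Suc.IH[of "k + 1"] Suc.prems by auto
    have "enat m \<le> tail X k \<Longrightarrow> enat m \<le> tail X (k - 1)"
      using antimonoD[OF am, of "k - 1" k] by (auto intro: order_trans)
    moreover have "tail ?Y k = X k + of_bool (tail X k < enat m \<and> enat m \<le> tail X (k - 1))
        + (tail X (k + 1) + of_bool (enat m \<le> tail X k))"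
      unfolding tail_rec[OF R', of k] IH by (simp add: ibm_move_eq[OF R m])
    moreover have "tail X k = X k + tail X (k + 1)" by (rule tail_rec[OF R])
    ultimately show ?case
      by (cases "enat m \<le> tail X k") (simp_all add: ac_simps not_le[symmetric])
  qed
  show ?thesis
    using gen[of "nat (R + 2 - k)"] by linarith
qed

lemma ibm_right_bounded:
  assumes "\<forall>j>R. X0 j = 0" and "\<forall>n. 1 \<le> \<omega> n"
  shows "\<forall>j>R + int n. ibm X0 \<omega> n j = 0"
proof (induction n)
  case 0
  then show ?case using assms(1) by simp
next
  case (Suc n)
  have "tail (ibm X0 \<omega> n) (j - 1) = 0" if "R + int (Suc n) < j" for j
    by (subst tail_eq_sum[of "R + int n"]) (use Suc that in auto)
  moreover have "1 \<le> \<omega> n" using assms(2) by simp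
  ultimately show ?case
    using Suc by (auto simp: ibm_move_eq[OF Suc.IH] zero_enat_def)
qed

lemma tail_ibm:
  assumes "\<forall>j>R. X0 j = 0" and "\<forall>n. 1 \<le> \<omega> n"
  shows "tail (ibm X0 \<omega> n) = tails (tail X0) \<omega> n"
proof (induction n)
  case (Suc n)
  show ?case
    by (rule ext) (use Suc assms(2) in \<open>simp add: tail_ibm_move[OF ibm_right_bounded[OF assms]]\<close>)
qed simp

lemma ibm_eq_visits:
  assumes "\<forall>j>R. X0 j = 0" and "\<forall>n. 1 \<le> \<omega> n"
  shows "ibm X0 \<omega> n k = X0 k + enat (visits (gap (tail X0) k) \<omega> n)"
proof (induction n)
  case (Suc n)
  have "ibm X0 \<omega> (Suc n) k = ibm X0 \<omega> n k + of_bool (\<omega> n \<in> gap (tail X0) k \<omega> n)"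
    using assms(2) by (simp add: ibm_move_eq[OF ibm_right_bounded[OF assms]] tail_ibm[OF assms] gap_def)
  then show ?case
    by (cases "X0 k") (auto simp: Suc visits_Suc one_enat_def zero_enat_def)
qed (simp add: zero_enat_def[symmetric])

text \<open>This reduces the theorem to the question which gaps are hit infinitely often.\<close>

lemma ibm_limit_infinite_iff:
  assumes X0: "X0 \<in> configs" and \<omega>: "\<forall>n. 1 \<le> \<omega> n"
  shows "ibm_limit X0 \<omega> k = \<infinity> \<longleftrightarrow>
    X0 k = \<infinity> \<or> infinite {n. \<omega> n \<in> gap (tail X0) k \<omega> n}"
proof -
  obtain R where R: "\<forall>j>R. X0 j = 0"
    using configs_right_bounded[OF X0] by metis
  let ?v = "visits (gap (tail X0) k) \<omega>"
  let ?f = "\<lambda>n. X0 k + enat (?v n)"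
  have eq: "(\<lambda>n. ibm X0 \<omega> n k) = ?f"
    using ibm_eq_visits[OF _ \<omega>] R by blast
  have "incseq ?f"
    by (intro monoI add_left_mono) (auto intro: visits_mono)
  then have "?f \<longlonglongrightarrow> (SUP n. ?f n)" by (rule LIMSEQ_SUP)
  then have lim: "ibm_limit X0 \<omega> k = (SUP n. ?f n)"
    unfolding ibm_limit_def eq by (rule limI)
  show ?thesis
  proof (cases "finite {n. \<omega> n \<in> gap (tail X0) k \<omega> n} \<and> X0 k \<noteq> \<infinity>")
    case True
    then obtain B where B: "\<And>n. ?v n \<le> B"
      using finite_visits_iff[of \<omega> "gap (tail X0) k"] by blast
    have "(SUP n. ?f n) \<le> X0 k + enat B"
      by (intro SUP_least add_left_mono) (use B in simp)
    also have "\<dots> < \<infinity>" using True by (cases "X0 k") auto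
    finally show ?thesis using True lim by auto
  next
    case False
    have ge: "enat m \<le> (SUP n. ?f n)" for m
    proof -
      have "\<exists>n. enat m \<le> ?f n"
      proof (cases "X0 k = \<infinity>")
        case finite: False
        with False obtain n where "m \<le> ?v n"
          using finite_visits_iff[of \<omega> "gap (tail X0) k"] by (meson nle_le)
        then have "enat m \<le> enat (?v n)" by simp
        also have "\<dots> \<le> ?f n" by simp
        finally show ?thesis by blast
      qed auto
      then obtain n where "enat m \<le> ?f n" by blast
      also have "\<dots> \<le> (SUP n. ?f n)" by (rule SUP_upper) simp
      finally show ?thesis .
    qed
    then have "(SUP n. ?f n) = \<infinity>"
    proof (cases "SUP n. ?f n")
      case (enat m)
      with ge[of "Suc m"] show ?thesis by simp
    qed simp
    with False lim show ?thesis by auto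
  qed
qed

section \<open>Sequences of independent moves\<close>

abbreviation seqs :: "nat pmf \<Rightarrow> (nat \<Rightarrow> nat) measure" where
  "seqs \<mu> \<equiv> (\<Pi>\<^sub>M n\<in>(UNIV :: nat set). measure_pmf \<mu>)"

lemma prob_space_seqs: "prob_space (seqs \<mu>)"
  by (intro prob_space_PiM prob_space_measure_pmf)

lemma space_seqs [simp]: "space (seqs \<mu>) = UNIV"
  by (simp add: space_PiM)

text \<open>As the moves take countably many values, a function of the first \<open>n\<close> moves is automatically measurable
  (\<open>measurable_adapted\<close>), so this single notion replaces a filtration.\<close>

definition adapted :: "nat \<Rightarrow> ((nat \<Rightarrow> nat) \<Rightarrow> 'b) \<Rightarrow> bool" where
  "adapted n f \<longleftrightarrow> (\<forall>\<omega> \<omega>'. (\<forall>i<n. \<omega> i = \<omega>' i) \<longrightarrow> f \<omega> = f \<omega>')"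

lemma adaptedD: "adapted n f \<Longrightarrow> (\<And>i. i < n \<Longrightarrow> \<omega> i = \<omega>' i) \<Longrightarrow> f \<omega> = f \<omega>'"
  by (simp add: adapted_def)

lemma adapted_const: "adapted n (\<lambda>_. c)"
  by (simp add: adapted_def)

lemma adapted_compose: "adapted n f \<Longrightarrow> adapted n (\<lambda>\<omega>. h (f \<omega>))"
  unfolding adapted_def by metis

lemma adapted_compose2: "adapted n f \<Longrightarrow> adapted n g \<Longrightarrow> adapted n (\<lambda>\<omega>. h (f \<omega>) (g \<omega>))"
  unfolding adapted_def by metis

lemma adapted_mono: "adapted m f \<Longrightarrow> m \<le> n \<Longrightarrow> adapted n f"
  unfolding adapted_def by (meson order_less_le_trans)

lemma adapted_coordinate: "i < n \<Longrightarrow> adapted n (\<lambda>\<omega>. \<omega> i)"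
  by (simp add: adapted_def)

lemma adapted_tails: "adapted n (\<lambda>\<omega>. tails a \<omega> n)"
proof (induction n)
  case (Suc n)
  then show ?case unfolding adapted_def by simp (metis less_Suc_eq)
qed (simp add: adapted_def)

lemma adapted_gap: "adapted n (\<lambda>\<omega>. gap a k \<omega> n)"
  unfolding gap_def
  by (rule adapted_compose[OF adapted_tails, of _ "\<lambda>t. {x. t k < enat x \<and> enat x \<le> t (k - 1)}"])

lemma adapted_visits:
  assumes "\<And>i. adapted i (\<lambda>\<omega>. W \<omega> i)"
  shows "adapted n (\<lambda>\<omega>. visits W \<omega> n)"
proof -
  have "{i. i < n \<and> \<omega> i \<in> W \<omega> i} = {i. i < n \<and> \<omega>' i \<in> W \<omega>' i}" if "\<And>i. i < n \<Longrightarrow> \<omega> i = \<omega>' i" for \<omega> \<omega>'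
  proof -
    have "W \<omega> i = W \<omega>' i" if "i < n" for i
      using adaptedD[OF assms, of i \<omega> \<omega>'] \<open>\<And>i. i < n \<Longrightarrow> \<omega> i = \<omega>' i\<close> that by (meson less_trans)
    with that show ?thesis by auto
  qed
  then show ?thesis unfolding adapted_def visits_def by metis
qed

lemma measurable_prefix:
  "(\<lambda>\<omega>. map \<omega> [0..<n]) \<in> measurable (seqs \<mu>) (count_space UNIV)"
proof (induction n)
  case (Suc n)
  have "(\<lambda>\<omega>. \<omega> n) \<in> measurable (seqs \<mu>) (measure_pmf \<mu>)"
    by (rule measurable_component_singleton) simp
  then have c: "(\<lambda>\<omega>. \<omega> n) \<in> measurable (seqs \<mu>) (count_space UNIV)"
    by simp
  have "(\<lambda>\<omega>. map \<omega> [0..<n] @ [x]) \<in> measurable (seqs \<mu>) (count_space UNIV)" for x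
    using measurable_compose[OF Suc, of "\<lambda>l. l @ [x]"] by simp
  from measurable_compose_countable[OF this c] show ?case by simp
qed simp

lemma measurable_adapted:
  assumes "adapted n f" "space N = UNIV"
  shows "f \<in> measurable (seqs \<mu>) N"
proof -
  let ?h = "\<lambda>l. f (\<lambda>i. if i < n then l ! i else 0)"
  have "f = (\<lambda>\<omega>. ?h (map \<omega> [0..<n]))"
    using assms(1) by (intro ext adaptedD[OF assms(1)]) simp
  moreover have "(\<lambda>\<omega>. ?h (map \<omega> [0..<n])) \<in> measurable (seqs \<mu>) N"
    by (rule measurable_compose[OF measurable_prefix]) (simp add: assms(2))
  ultimately show ?thesis by metis
qed

lemma sets_adapted:
  assumes "adapted n Q" shows "{\<omega>. Q \<omega>} \<in> sets (seqs \<mu>)"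
  using measurable_adapted[OF assms, of "count_space UNIV" \<mu>]
  by (simp add: pred_def[symmetric] pred_def)

text \<open>Resampling coordinate \<open>n\<close> preserves the product measure, so the next value may be integrated out independently of
  anything that is determined by the first \<open>n\<close> values.\<close>

lemma nn_integral_fresh:
  fixes f :: "(nat \<Rightarrow> nat) \<Rightarrow> nat \<Rightarrow> ennreal"
  assumes "adapted n f"
  shows "(\<integral>\<^sup>+\<omega>. f \<omega> (\<omega> n) \<partial>seqs \<mu>) = (\<integral>\<^sup>+\<omega>. (\<integral>\<^sup>+x. f \<omega> x \<partial>measure_pmf \<mu>) \<partial>seqs \<mu>)"
proof -
  interpret S: prob_space "seqs \<mu>" by (rule prob_space_seqs)
  interpret pair_sigma_finite "measure_pmf \<mu>" "seqs \<mu>" ..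
  let ?upd = "\<lambda>(x :: nat, \<omega> :: nat \<Rightarrow> nat). fun_upd \<omega> n x"
  have eq: "distr (measure_pmf \<mu> \<Otimes>\<^sub>M seqs \<mu>) (seqs \<mu>) ?upd = seqs \<mu>"
    using distr_pair_PiM_eq_PiM[of UNIV "\<lambda>_. measure_pmf \<mu>" n]
    by (simp add: prob_space_measure_pmf)
  have m_upd: "?upd \<in> measurable (measure_pmf \<mu> \<Otimes>\<^sub>M seqs \<mu>) (seqs \<mu>)"
  proof (rule measurable_PiM_single')
    fix i :: nat
    have "(\<lambda>p. snd p i) \<in> measurable (measure_pmf \<mu> \<Otimes>\<^sub>M seqs \<mu>) (measure_pmf \<mu>)"
      by (rule measurable_compose[OF measurable_snd measurable_component_singleton]) simp
    then show "(\<lambda>p. ?upd p i) \<in> measurable (measure_pmf \<mu> \<Otimes>\<^sub>M seqs \<mu>) (measure_pmf \<mu>)"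
      using measurable_fst[of "measure_pmf \<mu>" "seqs \<mu>"]
      by (cases "i = n") (simp_all add: split_beta del: measurable_pmf_measure1 measurable_pmf_measure2)
  qed (auto simp: PiE_def extensional_def)
  have "adapted (Suc n) (\<lambda>\<omega>. f \<omega> (\<omega> n))"
    by (rule adapted_compose2[OF adapted_mono[OF assms] adapted_coordinate]) auto
  then have m1: "(\<lambda>\<omega>. f \<omega> (\<omega> n)) \<in> borel_measurable (seqs \<mu>)"
    by (rule measurable_adapted) simp
  have "(\<lambda>\<omega>. f \<omega> x) \<in> borel_measurable (seqs \<mu>)" for x
    by (rule measurable_adapted[OF adapted_compose[OF assms]]) simp
  then have m2: "(\<lambda>(x, \<omega>). f \<omega> x) \<in> borel_measurable (measure_pmf \<mu> \<Otimes>\<^sub>M seqs \<mu>)"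
    unfolding split_beta by (intro measurable_compose_countable[of "\<lambda>x p. f (snd p) x" _ _ fst]) simp_all
  have "(\<integral>\<^sup>+\<omega>. f \<omega> (\<omega> n) \<partial>seqs \<mu>) =
      (\<integral>\<^sup>+\<omega>. f \<omega> (\<omega> n) \<partial>distr (measure_pmf \<mu> \<Otimes>\<^sub>M seqs \<mu>) (seqs \<mu>) ?upd)"
    by (simp add: eq)
  also have "\<dots> = (\<integral>\<^sup>+p. f (?upd p) (?upd p n) \<partial>(measure_pmf \<mu> \<Otimes>\<^sub>M seqs \<mu>))"
    by (rule nn_integral_distr[OF m_upd]) (simp add: m1)
  also have "\<dots> = (\<integral>\<^sup>+p. (case p of (x, \<omega>) \<Rightarrow> f \<omega> x) \<partial>(measure_pmf \<mu> \<Otimes>\<^sub>M seqs \<mu>))"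
  proof (intro nn_integral_cong)
    fix p :: "nat \<times> (nat \<Rightarrow> nat)"
    obtain x \<omega> where p: "p = (x, \<omega>)" by fastforce
    have "f (fun_upd \<omega> n x) = f \<omega>" by (rule adaptedD[OF assms]) simp
    then show "f (?upd p) (?upd p n) = (case p of (x, \<omega>) \<Rightarrow> f \<omega> x)" by (simp add: p)
  qed
  also have "\<dots> = (\<integral>\<^sup>+\<omega>. (\<integral>\<^sup>+x. f \<omega> x \<partial>measure_pmf \<mu>) \<partial>seqs \<mu>)"
    using nn_integral_snd[OF m2] by simp
  finally show ?thesis .
qed

lemma nn_integral_fresh_indicator:
  assumes "adapted n W" "adapted n g"
  shows "(\<integral>\<^sup>+\<omega>. g \<omega> * indicator (W \<omega>) (\<omega> n) \<partial>seqs \<mu>) =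
    (\<integral>\<^sup>+\<omega>. g \<omega> * emeasure (measure_pmf \<mu>) (W \<omega>) \<partial>seqs \<mu>)"
proof -
  have "adapted n (\<lambda>\<omega> x. g \<omega> * indicator (W \<omega>) x)"
    by (rule adapted_compose2[OF assms(2,1)])
  from nn_integral_fresh[OF this, of \<mu>] show ?thesis
    by (simp add: nn_integral_cmult)
qed

definition compensator ::
  "nat pmf \<Rightarrow> ((nat \<Rightarrow> nat) \<Rightarrow> nat \<Rightarrow> nat set) \<Rightarrow> (nat \<Rightarrow> nat) \<Rightarrow> nat \<Rightarrow> real" where
  "compensator \<mu> W \<omega> n = (\<Sum>i<n. measure (measure_pmf \<mu>) (W \<omega> i))"

lemma adapted_compensator:
  assumes "\<And>i. adapted i (\<lambda>\<omega>. W \<omega> i)"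
  shows "adapted n (\<lambda>\<omega>. compensator \<mu> W \<omega> (Suc n))"
proof (induction n)
  case 0
  show ?case using adapted_compose[OF assms[of 0]] by (simp add: compensator_def)
next
  case (Suc n)
  have "adapted (Suc n) (\<lambda>\<omega>. compensator \<mu> W \<omega> (Suc n) + measure (measure_pmf \<mu>) (W \<omega> (Suc n)))"
    by (rule adapted_compose2[OF adapted_mono[OF Suc] assms]) simp
  then show ?case by (simp add: compensator_def)
qed

text \<open>The integrand is a supermartingale: an indicator with conditional probability \<open>p\<close> multiplies the expectation by
  \<open>1 + (exp l - 1) * p \<le> exp ((exp l - 1) * p)\<close>. It is used with \<open>l = 1\<close> to bound
  visits from above and with \<open>l = - 1\<close> to bound them from below.\<close>

lemma exponential_moment_visits_le_1:
  fixes l :: real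
  assumes W: "\<And>i. adapted i (\<lambda>\<omega>. W \<omega> i)"
  shows "(\<integral>\<^sup>+\<omega>. ennreal (exp (l * visits W \<omega> n - (exp l - 1) * compensator \<mu> W \<omega> n)) \<partial>seqs \<mu>) \<le> 1"
proof (induction n)
  case 0
  interpret S: prob_space "seqs \<mu>" by (rule prob_space_seqs)
  show ?case using S.emeasure_space_1 by (simp add: compensator_def)
next
  case (Suc n)
  let ?e = "exp l - 1"
  let ?f = "\<lambda>\<omega> x. ennreal (exp (l * visits W \<omega> n - ?e * compensator \<mu> W \<omega> (Suc n)) *
              (1 + ?e * indicator (W \<omega> n) x))"
  have pos: "0 \<le> 1 + ?e * indicator (W \<omega> n) x" for \<omega> x
    by (simp add: indicator_def)
  have ad: "adapted n ?f"
  proof -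
    have "adapted n (\<lambda>\<omega>. (visits W \<omega> n, compensator \<mu> W \<omega> (Suc n)))"
      by (rule adapted_compose2[OF adapted_visits[OF W] adapted_compensator[OF W]])
    from adapted_compose2[OF this W[of n], of "\<lambda>(v, c) w x. ennreal (exp (l * real v - ?e * c) *
              (1 + ?e * indicator w x))"]
    show ?thesis by simp
  qed
  have step: "exp (l * visits W \<omega> (Suc n) - ?e * compensator \<mu> W \<omega> (Suc n)) =
      exp (l * visits W \<omega> n - ?e * compensator \<mu> W \<omega> (Suc n)) * (1 + ?e * indicator (W \<omega> n) (\<omega> n))" for \<omega>
    by (simp add: visits_Suc indicator_def algebra_simps exp_add exp_diff)
  have inner: "(\<integral>\<^sup>+x. ?f \<omega> x \<partial>measure_pmf \<mu>) \<le>
      ennreal (exp (l * visits W \<omega> n - ?e * compensator \<mu> W \<omega> n))" for \<omega>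
  proof -
    let ?p = "measure (measure_pmf \<mu>) (W \<omega> n)"
    have "(\<integral>\<^sup>+x. ennreal (1 + ?e * indicator (W \<omega> n) x) \<partial>measure_pmf \<mu>) =
        ennreal (\<integral>x. 1 + ?e * indicator (W \<omega> n) x \<partial>measure_pmf \<mu>)"
      by (rule nn_integral_eq_integral) (use pos in \<open>auto intro!: measure_pmf.integrable_const_bound[where B="1 + \<bar>?e\<bar>"] simp: indicator_def\<close>)
    also have "(\<integral>x. 1 + ?e * indicator (W \<omega> n) x \<partial>measure_pmf \<mu>) = 1 + ?e * ?p"
    proof -
      have "integrable (measure_pmf \<mu>) (\<lambda>x. indicator (W \<omega> n) x :: real)"
        by (rule measure_pmf.integrable_const_bound[where B=1]) auto
      then show ?thesis
        by (subst Bochner_Integration.integral_add) (auto simp: measure_pmf.prob_space)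
    qed
    also have "ennreal (1 + ?e * ?p) \<le> ennreal (exp (?e * ?p))"
      by (intro ennreal_leI exp_ge_add_one_self)
    finally have A: "(\<integral>\<^sup>+x. ennreal (1 + ?e * indicator (W \<omega> n) x) \<partial>measure_pmf \<mu>) \<le> ennreal (exp (?e * ?p))" .
    have "(\<integral>\<^sup>+x. ?f \<omega> x \<partial>measure_pmf \<mu>) =
        ennreal (exp (l * visits W \<omega> n - ?e * compensator \<mu> W \<omega> (Suc n))) *
        (\<integral>\<^sup>+x. ennreal (1 + ?e * indicator (W \<omega> n) x) \<partial>measure_pmf \<mu>)"
      by (subst nn_integral_cmult[symmetric]) (auto simp: ennreal_mult' pos)
    also have "\<dots> \<le> ennreal (exp (l * visits W \<omega> n - ?e * compensator \<mu> W \<omega> (Suc n))) * ennreal (exp (?e * ?p))"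
      by (rule mult_left_mono[OF A]) simp
    also have "\<dots> = ennreal (exp (l * visits W \<omega> n - ?e * compensator \<mu> W \<omega> n))"
      by (simp add: ennreal_mult[symmetric] exp_add[symmetric] compensator_def algebra_simps)
    finally show ?thesis .
  qed
  have "(\<integral>\<^sup>+\<omega>. ennreal (exp (l * visits W \<omega> (Suc n) - ?e * compensator \<mu> W \<omega> (Suc n))) \<partial>seqs \<mu>) =
      (\<integral>\<^sup>+\<omega>. ?f \<omega> (\<omega> n) \<partial>seqs \<mu>)"
    by (simp only: step)
  also have "\<dots> = (\<integral>\<^sup>+\<omega>. (\<integral>\<^sup>+x. ?f \<omega> x \<partial>measure_pmf \<mu>) \<partial>seqs \<mu>)"
    by (rule nn_integral_fresh[OF ad])
  also have "\<dots> \<le> (\<integral>\<^sup>+\<omega>. ennreal (exp (l * visits W \<omega> n - ?e * compensator \<mu> W \<omega> n)) \<partial>seqs \<mu>)"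
    by (rule nn_integral_mono) (rule inner)
  also have "\<dots> \<le> 1" by (rule Suc)
  finally show ?case .
qed

lemma measure_exponential_bound:
  fixes l t :: real
  assumes "adapted n (\<lambda>\<omega>. Q \<omega>)" and W: "\<And>i. adapted i (\<lambda>\<omega>. W \<omega> i)"
    and Q: "\<And>\<omega>. Q \<omega> \<Longrightarrow> t \<le> l * visits W \<omega> n - (exp l - 1) * compensator \<mu> W \<omega> n"
  shows "measure (seqs \<mu>) {\<omega>. Q \<omega>} \<le> exp (- t)"
proof -
  interpret S: prob_space "seqs \<mu>" by (rule prob_space_seqs)
  let ?e = "\<lambda>\<omega>. l * visits W \<omega> n - (exp l - 1) * compensator \<mu> W \<omega> n"
  have [measurable]: "{\<omega>. Q \<omega>} \<in> sets (seqs \<mu>)" by (rule sets_adapted[OF assms(1)])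
  have "ennreal (exp t) * emeasure (seqs \<mu>) {\<omega>. Q \<omega>} =
      (\<integral>\<^sup>+\<omega>. ennreal (exp t) * indicator {\<omega>. Q \<omega>} \<omega> \<partial>seqs \<mu>)"
    by (simp add: nn_integral_cmult_indicator)
  also have "\<dots> \<le> (\<integral>\<^sup>+\<omega>. ennreal (exp (?e \<omega>)) \<partial>seqs \<mu>)"
    by (intro nn_integral_mono) (auto simp: indicator_def intro!: ennreal_leI Q)
  also have "\<dots> \<le> 1"
    by (rule exponential_moment_visits_le_1[OF W])
  finally have "ennreal (exp t * measure (seqs \<mu>) {\<omega>. Q \<omega>}) \<le> ennreal 1"
    by (simp add: S.emeasure_eq_measure ennreal_mult)
  then have "exp t * measure (seqs \<mu>) {\<omega>. Q \<omega>} \<le> 1"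
    by (subst (asm) ennreal_le_iff) auto
  then show ?thesis
    by (simp add: exp_minus field_simps)
qed

text \<open>Any fraction below one half would serve in place of one third: it leaves room to show that tails eventually exceed
  \<open>n div 2\<close>.\<close>

definition mostly_below :: "nat \<Rightarrow> (nat \<Rightarrow> nat) \<Rightarrow> bool" where
  "mostly_below m \<omega> \<longleftrightarrow> (\<forall>\<^sub>F n in sequentially. 3 * visits (\<lambda>_ _. {m<..}) \<omega> n \<le> n)"

text \<open>A move beyond \<open>m\<close> has probability at most \<open>1 / 8\<close>, so the exponential moment with
  \<open>l = 1\<close> gives more than \<open>n / 3\<close> of them with probability at most
  \<open>exp (- (1 / 3 - (exp 1 - 1) / 8) * n) \<le> exp (- n / 12)\<close>, which is summable.\<close>

lemma AE_mostly_below: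
  assumes "7 / 8 \<le> measure (measure_pmf \<mu>) {..m}"
  shows "AE \<omega> in seqs \<mu>. mostly_below m \<omega>"
proof -
  interpret S: prob_space "seqs \<mu>" by (rule prob_space_seqs)
  let ?W = "\<lambda>(_ :: nat \<Rightarrow> nat) (_ :: nat). {m<..}"
  let ?A = "\<lambda>n. {\<omega>. n < 3 * visits ?W \<omega> n}"
  define q where "q = measure (measure_pmf \<mu>) {m<..}"
  have "{m<..} = UNIV - {..m}" by auto
  then have "q = 1 - measure (measure_pmf \<mu>) {..m}"
    unfolding q_def using measure_pmf.prob_compl[of "{..m}" \<mu>] by simp
  with assms have q: "0 \<le> q" "q \<le> 1 / 8" by (auto simp: q_def)
  have ad: "adapted n (\<lambda>\<omega>. n < 3 * visits ?W \<omega> n)" for n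
    by (rule adapted_compose[OF adapted_visits]) (rule adapted_const)
  have e1: "(exp 1 - 1) * q \<le> 1 / 4"
  proof -
    have "(exp 1 - 1) * q \<le> (3 - 1) * (1 / 8)"
      using exp_le q by (intro mult_mono) auto
    then show ?thesis by simp
  qed
  have "measure (seqs \<mu>) (?A n) \<le> exp (- (real n / 12))" for n
  proof (rule measure_exponential_bound[OF ad, where l=1 and W="?W"])
    fix \<omega> assume "n < 3 * visits ?W \<omega> n"
    moreover have "compensator \<mu> ?W \<omega> n = real n * q"
      by (simp add: compensator_def q_def)
    moreover have "real n * ((exp 1 - 1) * q) \<le> real n * (1 / 4)"
      by (rule mult_left_mono[OF e1]) simp
    ultimately show "real n / 12 \<le> 1 * real (visits ?W \<omega> n) - (exp 1 - 1) * compensator \<mu> ?W \<omega> n"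
      by (simp add: algebra_simps)
  qed (rule adapted_const)
  moreover have "exp (- (real n / 12)) = exp (- (1 / 12)) ^ n" for n
    by (simp add: exp_of_nat_mult[symmetric])
  ultimately have le: "measure (seqs \<mu>) (?A n) \<le> exp (- (1 / 12)) ^ n" for n
    by metis
  have "summable (\<lambda>n. exp (- (1 / 12) :: real) ^ n)"
    by (rule summable_geometric) simp
  then have "summable (\<lambda>n. measure (seqs \<mu>) (?A n))"
    by (rule summable_comparison_test'[where N=0]) (use le in simp)
  then have "AE \<omega> in seqs \<mu>. eventually (\<lambda>n. \<omega> \<in> space (seqs \<mu>) - ?A n) sequentially"
    by (intro borel_cantelli_AE1 sets_adapted[OF ad]) (auto simp: S.emeasure_eq_measure)
  then show ?thesis
    by eventually_elim (auto simp: mostly_below_def not_less elim: eventually_mono)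
qed

lemma exists_typical_bound:
  fixes \<mu> :: "nat pmf"
  obtains m where "7 / 8 \<le> measure (measure_pmf \<mu>) {..m}"
proof -
  have "(\<lambda>m. measure (measure_pmf \<mu>) {..m}) \<longlonglongrightarrow> measure (measure_pmf \<mu>) (\<Union>m. {..m})"
    by (rule measure_pmf.finite_Lim_measure_incseq) (auto simp: incseq_def)
  moreover have "(\<Union>m::nat. {..m}) = UNIV" by auto
  ultimately have "(\<lambda>m. measure (measure_pmf \<mu>) {..m}) \<longlonglongrightarrow> 1"
    by (simp add: measure_pmf.prob_space)
  then have "\<forall>\<^sub>F m in sequentially. 7 / 8 < measure (measure_pmf \<mu>) {..m}"
    by (rule order_tendstoD) simp
  then show ?thesis
    using that by (meson eventually_happens' less_imp_le sequentially_bot)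
qed

section \<open>Evolution and growth of the tails\<close>

lemma tails_mono_time: "n \<le> n' \<Longrightarrow> tails a \<omega> n k \<le> tails a \<omega> n' k"
  by (induction n' rule: dec_induct) (auto intro: order_trans)

lemma tails_initial_le: "a k \<le> tails a \<omega> n k"
  using tails_mono_time[of 0 n a \<omega> k] by simp

lemma antimono_tails: "antimono a \<Longrightarrow> antimono (tails a \<omega> n)"
proof (induction n)
  case (Suc n)
  then have am: "antimono (tails a \<omega> n)" by simp
  show ?case
  proof (rule antimonoI)
    fix k l :: int assume "k \<le> l"
    then have "tails a \<omega> n l \<le> tails a \<omega> n k" "tails a \<omega> n (l - 1) \<le> tails a \<omega> n (k - 1)"
      using antimonoD[OF am] by auto
    moreover from this have "of_bool (enat (\<omega> n) \<le> tails a \<omega> n (l - 1)) \<le>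
        (of_bool (enat (\<omega> n) \<le> tails a \<omega> n (k - 1)) :: enat)"
      by (auto dest: order_trans)
    ultimately show "tails a \<omega> (Suc n) l \<le> tails a \<omega> (Suc n) k"
      unfolding tails.simps by (intro add_mono)
  qed
qed simp

lemma tails_eq_infinity: "tails a \<omega> n k = \<infinity> \<longleftrightarrow> a k = \<infinity>"
  by (induction n) (auto simp: one_enat_def)

text \<open>The content of bin \<open>k\<close> is the difference of the tails of \<open>k\<close> and \<open>k + 1\<close>, and it has
  grown by one with each hit of the gap. The identity is arranged without subtraction because the tails may be infinite.\<close>

lemma tails_balance:
  assumes "antimono a"
  shows "tails a \<omega> n k + a (k + 1) = tails a \<omega> n (k + 1) + a k + enat (visits (gap a k) \<omega> n)"
proof (induction n)
  case 0
  show ?case by (simp add: zero_enat_def[symmetric] ac_simps)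
next
  case (Suc n)
  have "tails a \<omega> n k \<le> tails a \<omega> n (k - 1)"
    using antimonoD[OF antimono_tails[OF assms]] by simp
  then have "of_bool (enat (\<omega> n) \<le> tails a \<omega> n (k - 1)) =
      of_bool (enat (\<omega> n) \<le> tails a \<omega> n k) + (of_bool (\<omega> n \<in> gap a k \<omega> n) :: enat)"
    by (auto simp: gap_def not_le[symmetric])
  moreover have "enat (visits (gap a k) \<omega> (Suc n)) =
      enat (visits (gap a k) \<omega> n) + of_bool (\<omega> n \<in> gap a k \<omega> n)"
    by (auto simp: visits_Suc one_enat_def zero_enat_def)
  ultimately show ?case
    using Suc by (simp add: ac_simps)
qed

lemma visits_gap_le_tails: "enat (visits (gap a k) \<omega> n) \<le> tails a \<omega> n k"
proof (induction n)
  case (Suc n)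
  have "enat (visits (gap a k) \<omega> (Suc n)) =
      enat (visits (gap a k) \<omega> n) + of_bool (\<omega> n \<in> gap a k \<omega> n)"
    by (auto simp: visits_Suc one_enat_def zero_enat_def)
  also have "of_bool (\<omega> n \<in> gap a k \<omega> n) \<le> (of_bool (enat (\<omega> n) \<le> tails a \<omega> n (k - 1)) :: enat)"
    by (auto simp: gap_def)
  with Suc have "enat (visits (gap a k) \<omega> n) + of_bool (\<omega> n \<in> gap a k \<omega> n) \<le> tails a \<omega> (Suc n) k"
    unfolding tails.simps by (intro add_mono)
  finally show ?case .
qed (simp add: zero_enat_def[symmetric])

text \<open>Every move from time \<open>n1\<close> on that does not exceed \<open>m\<close> increases the tail of \<open>k\<close>, and at
  most \<open>n / 3\<close> moves exceed \<open>m\<close>, so the tail is at least \<open>2 * n / 3 - n1\<close>.\<close>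

lemma tails_growth_step:
  assumes "mostly_below m \<omega>" and "\<forall>\<^sub>F n in sequentially. enat m \<le> tails a \<omega> n (k - 1)"
  shows "\<forall>\<^sub>F n in sequentially. enat (n div 2 + c) \<le> tails a \<omega> n k"
proof -
  let ?V = "\<lambda>n. visits (\<lambda>_ _. {m<..}) \<omega> n"
  obtain n1 where n1: "\<And>n. n1 \<le> n \<Longrightarrow> enat m \<le> tails a \<omega> n (k - 1)"
    using assms(2) by (auto simp: eventually_sequentially)
  have count: "enat n \<le> tails a \<omega> n k + enat (?V n + n1)" if "n1 \<le> n" for n
    using that
  proof (induction n rule: dec_induct)
    case base
    show ?case by (simp add: add_increasing)
  next
    case (step n)
    have "1 \<le> of_bool (enat (\<omega> n) \<le> tails a \<omega> n (k - 1)) + enat (of_bool (m < \<omega> n))"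
      using n1[OF step(1)] order_trans[of "enat (\<omega> n)" "enat m" "tails a \<omega> n (k - 1)"]
      by (auto simp: one_enat_def not_less)
    with step.IH have "enat n + 1 \<le> tails a \<omega> n k + enat (?V n + n1) +
        (of_bool (enat (\<omega> n) \<le> tails a \<omega> n (k - 1)) + enat (of_bool (m < \<omega> n)))"
      by (rule add_mono)
    then show ?case
      by (cases "tails a \<omega> n k") (auto simp: visits_Suc one_enat_def zero_enat_def of_bool_def)
  qed
  have "\<forall>\<^sub>F n in sequentially. 3 * ?V n \<le> n \<and> 6 * (n1 + c) \<le> n"
    using assms(1) eventually_ge_at_top[of "6 * (n1 + c)"]
    unfolding mostly_below_def by (rule eventually_conj)
  then show ?thesis
  proof eventually_elim
    case (elim n)
    then have "enat n \<le> tails a \<omega> n k + enat (?V n + n1)" by (intro count) simp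
    with elim show ?case by (cases "tails a \<omega> n k") auto
  qed
qed

text \<open>Once the tail of a bin reaches a value \<open>m\<close> that most moves do not exceed, most moves also increase the tail of every
  later bin.\<close>

lemma tails_growth:
  assumes below: "mostly_below m \<omega>" and "enat m \<le> a p" and "p < k"
  shows "\<forall>\<^sub>F n in sequentially. enat (n div 2 + c) \<le> tails a \<omega> n k"
  using \<open>p < k\<close>
proof (induction k arbitrary: c rule: int_gr_induct)
  case base
  have "enat m \<le> tails a \<omega> n p" for n
    using assms(2) tails_initial_le by (rule order_trans)
  then show ?case by (intro tails_growth_step[OF below]) simp
next
  case (step k)
  have "\<forall>\<^sub>F n in sequentially. enat m \<le> tails a \<omega> n k"
    using step(2)[of m] by eventually_elim (metis enat_ord_simps(1) le_add2 order_trans)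
  then show ?case by (intro tails_growth_step[OF below]) simp
qed

section \<open>Windows above a tail are hit finitely often\<close>

text \<open>The tail of bin \<open>k\<close> stays at the value \<open>t\<close> for a geometric number of steps, of mean at most
  \<open>1 / \<mu> {..m}\<close> when \<open>m \<le> t\<close>, and each of these steps has probability
  \<open>\<mu> (t + c)\<close> of drawing \<open>t + c\<close>. Summing over \<open>t\<close> gives a finite expected number
  of such draws.\<close>

definition finite_windows :: "nat \<Rightarrow> (int \<Rightarrow> enat) \<Rightarrow> (nat \<Rightarrow> nat) \<Rightarrow> bool" where
  "finite_windows m a \<omega> \<longleftrightarrow>
    (\<forall>k c. 1 \<le> c \<longrightarrow> finite {n. \<exists>t. tails a \<omega> n k = enat t \<and> m \<le> t \<and> \<omega> n = t + c})"

lemma AE_finite_window: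
  assumes am: "antimono a" and pos: "0 < measure (measure_pmf \<mu>) {..m}"
  shows "AE \<omega> in seqs \<mu>. finite {n. \<exists>t. tails a \<omega> n k = enat t \<and> m \<le> t \<and> \<omega> n = t + c}"
proof -
  interpret S: prob_space "seqs \<mu>" by (rule prob_space_seqs)
  let ?mu = "measure_pmf \<mu>"
  define F where "F = measure ?mu {..m}"
  define W where "W = (\<lambda>\<omega> n. {x. \<exists>t. tails a \<omega> n k = enat t \<and> m \<le> t \<and> x = t + c})"
  define V where "V = (\<lambda>\<omega> n. {x. enat x \<le> tails a \<omega> n (k - 1)})"
  define g where "g = (\<lambda>\<omega> n. emeasure ?mu (W \<omega> n))"
  let ?A = "\<lambda>n. {\<omega>. \<omega> n \<in> W \<omega> n}"
  have adW: "adapted n (\<lambda>\<omega>. W \<omega> n)" for n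
    unfolding W_def by (rule adapted_compose[OF adapted_tails, of _ "\<lambda>T. {x. \<exists>t. T k = enat t \<and> m \<le> t \<and> x = t + c}"])
  have adV: "adapted n (\<lambda>\<omega>. V \<omega> n)" for n
    unfolding V_def by (rule adapted_compose[OF adapted_tails, of _ "\<lambda>T. {x. enat x \<le> T (k - 1)}"])
  have adg: "adapted n (\<lambda>\<omega>. g \<omega> n)" for n
    unfolding g_def by (rule adapted_compose[OF adW])
  have adA: "adapted (Suc n) (\<lambda>\<omega>. \<omega> n \<in> W \<omega> n)" for n
    by (rule adapted_compose2[OF adapted_coordinate adapted_mono[OF adW]]) auto
  have mg: "(\<lambda>\<omega>. g \<omega> n) \<in> borel_measurable (seqs \<mu>)" for n
    by (rule measurable_adapted[OF adg]) simp
  have "adapted (Suc n) (\<lambda>\<omega>. g \<omega> n * indicator (V \<omega> n) (\<omega> n))" for n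
    by (rule adapted_compose2[OF adapted_mono[OF adg]
          adapted_compose2[OF adapted_coordinate adapted_mono[OF adV]], of _ _ _ _ "\<lambda>x y. x * y" "\<lambda>x B. indicator B x"]) auto
  then have mgV: "(\<lambda>\<omega>. g \<omega> n * indicator (V \<omega> n) (\<omega> n)) \<in> borel_measurable (seqs \<mu>)" for n
    by (rule measurable_adapted) simp
  have EA: "emeasure (seqs \<mu>) (?A n) = (\<integral>\<^sup>+\<omega>. g \<omega> n \<partial>seqs \<mu>)" for n
  proof -
    have "emeasure (seqs \<mu>) (?A n) = (\<integral>\<^sup>+\<omega>. indicator (?A n) \<omega> \<partial>seqs \<mu>)"
      by (subst nn_integral_indicator) (auto intro: sets_adapted[OF adA])
    also have "\<dots> = (\<integral>\<^sup>+\<omega>. 1 * indicator (W \<omega> n) (\<omega> n) \<partial>seqs \<mu>)"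
      by (intro nn_integral_cong) (simp add: indicator_def)
    also have "\<dots> = (\<integral>\<^sup>+\<omega>. 1 * emeasure ?mu (W \<omega> n) \<partial>seqs \<mu>)"
      by (rule nn_integral_fresh_indicator[OF adW adapted_const])
    finally show ?thesis by (simp add: g_def)
  qed
  \<comment> \<open>While the tail is at least \<open>m\<close>, so is the preceding one, and each step increases the tail with
    probability at least \<open>F\<close>.\<close>
  have jump: "ennreal F * (\<integral>\<^sup>+\<omega>. g \<omega> n \<partial>seqs \<mu>) \<le> (\<integral>\<^sup>+\<omega>. g \<omega> n * indicator (V \<omega> n) (\<omega> n) \<partial>seqs \<mu>)" for n
  proof -
    have "ennreal F * (\<integral>\<^sup>+\<omega>. g \<omega> n \<partial>seqs \<mu>) = (\<integral>\<^sup>+\<omega>. g \<omega> n * ennreal F \<partial>seqs \<mu>)"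
      using nn_integral_multc[OF mg[of n], of "ennreal F"] by (simp add: mult.commute)
    also have "\<dots> \<le> (\<integral>\<^sup>+\<omega>. g \<omega> n * emeasure ?mu (V \<omega> n) \<partial>seqs \<mu>)"
    proof (rule nn_integral_mono)
      fix \<omega>
      show "g \<omega> n * ennreal F \<le> g \<omega> n * emeasure ?mu (V \<omega> n)"
      proof (cases "\<exists>t. tails a \<omega> n k = enat t \<and> m \<le> t")
        case True
        then have "enat m \<le> tails a \<omega> n (k - 1)"
          using antimonoD[OF antimono_tails[OF am], of "k - 1" k \<omega> n]
          by (metis diff_le_eq enat_ord_simps(1) le_add_same_cancel1 order_trans zero_le_one)
        then have "{..m} \<subseteq> V \<omega> n" by (auto simp: V_def intro: order_trans[of _ "enat m"])
        then have "ennreal F \<le> emeasure ?mu (V \<omega> n)"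
          by (simp add: F_def measure_pmf.emeasure_eq_measure measure_pmf.finite_measure_mono)
        then show ?thesis by (rule mult_left_mono) simp
      next
        case False
        then have "W \<omega> n = {}" by (auto simp: W_def)
        then show ?thesis by (simp add: g_def)
      qed
    qed
    also have "\<dots> = (\<integral>\<^sup>+\<omega>. g \<omega> n * indicator (V \<omega> n) (\<omega> n) \<partial>seqs \<mu>)"
      by (rule nn_integral_fresh_indicator[OF adV adg, symmetric])
    finally show ?thesis .
  qed
  \<comment> \<open>The tail takes different values at the times at which it increases, so the point masses
    collected there belong to different points.\<close>
  have path: "(\<Sum>i<n. g \<omega> i * indicator (V \<omega> i) (\<omega> i)) \<le>
      emeasure ?mu {x. enat x < tails a \<omega> n k + enat c}" for \<omega> n
  proof (induction n)
    case (Suc n)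
    let ?B = "{x. enat x < tails a \<omega> n k + enat c}"
    let ?B' = "{x. enat x < tails a \<omega> (Suc n) k + enat c}"
    have "g \<omega> n * indicator (V \<omega> n) (\<omega> n) + emeasure ?mu ?B \<le> emeasure ?mu ?B'"
    proof (cases "\<omega> n \<in> V \<omega> n \<and> W \<omega> n \<noteq> {}")
      case True
      then obtain t where t: "tails a \<omega> n k = enat t" "m \<le> t" by (auto simp: W_def)
      have W: "W \<omega> n = {t + c}" using t by (auto simp: W_def)
      have B: "?B = {..<t + c}" by (auto simp: t)
      have "tails a \<omega> (Suc n) k = enat (t + 1)"
        using True by (simp add: t V_def one_enat_def)
      then have B': "?B' = {..<Suc (t + c)}" by (auto simp del: tails.simps)
      have "?B' = W \<omega> n \<union> ?B"
        unfolding W B B' lessThan_Suc by (rule insert_is_Un)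
      moreover have "W \<omega> n \<inter> ?B = {}" unfolding W B by simp
      ultimately have "emeasure ?mu ?B' = emeasure ?mu (W \<omega> n) + emeasure ?mu ?B"
        by (simp add: plus_emeasure)
      then show ?thesis using True by (simp add: g_def)
    next
      case False
      then have 0: "g \<omega> n * indicator (V \<omega> n) (\<omega> n) = 0" by (auto simp: g_def)
      have "?B \<subseteq> ?B'"
        using tails_mono_time[of n "Suc n" a \<omega> k]
        by (auto simp del: tails.simps intro: less_le_trans add_right_mono)
      then show ?thesis unfolding 0 add_0 by (rule emeasure_mono) simp
    qed
    then show ?case using Suc by (simp del: tails.simps add: add.commute) (meson add_left_mono order_trans)
  qed simp
  have sum_bound: "F * (\<Sum>n<N. measure (seqs \<mu>) (?A n)) \<le> 1" for N
  proof -
    have "ennreal (F * (\<Sum>n<N. measure (seqs \<mu>) (?A n))) = (\<Sum>n<N. ennreal F * (\<integral>\<^sup>+\<omega>. g \<omega> n \<partial>seqs \<mu>))"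
      by (simp add: EA[symmetric] S.emeasure_eq_measure sum_distrib_left F_def ennreal_mult[symmetric] sum_nonneg)
    also have "\<dots> \<le> (\<Sum>n<N. \<integral>\<^sup>+\<omega>. g \<omega> n * indicator (V \<omega> n) (\<omega> n) \<partial>seqs \<mu>)"
      by (intro sum_mono jump)
    also have "\<dots> = (\<integral>\<^sup>+\<omega>. (\<Sum>n<N. g \<omega> n * indicator (V \<omega> n) (\<omega> n)) \<partial>seqs \<mu>)"
      by (rule nn_integral_sum[symmetric]) (rule mgV)
    also have "\<dots> \<le> (\<integral>\<^sup>+\<omega>. 1 \<partial>seqs \<mu>)"
    proof (rule nn_integral_mono)
      fix \<omega>
      show "(\<Sum>n<N. g \<omega> n * indicator (V \<omega> n) (\<omega> n)) \<le> 1"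
        using path[of \<omega> N] measure_pmf.emeasure_le_1 by (rule order_trans)
    qed
    also have "\<dots> = ennreal 1" using S.emeasure_space_1 by simp
    finally show ?thesis by (subst (asm) ennreal_le_iff) auto
  qed
  have "summable (\<lambda>n. measure (seqs \<mu>) (?A n))"
  proof (rule summableI_nonneg_bounded)
    show "(\<Sum>n<N. measure (seqs \<mu>) (?A n)) \<le> 1 / F" for N
      using sum_bound[of N] pos by (simp add: F_def field_simps)
  qed simp
  then have "AE \<omega> in seqs \<mu>. eventually (\<lambda>n. \<omega> \<in> space (seqs \<mu>) - ?A n) sequentially"
    by (intro borel_cantelli_AE1 sets_adapted[OF adA]) (auto simp: S.emeasure_eq_measure)
  then show ?thesis
  proof eventually_elim
    case (elim \<omega>)
    then obtain N where "\<And>n. N \<le> n \<Longrightarrow> \<omega> n \<notin> W \<omega> n" by (auto simp: eventually_sequentially)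
    then have "{n. \<omega> n \<in> W \<omega> n} \<subseteq> {..<N}" by (auto simp: not_le[symmetric])
    then have "finite {n. \<omega> n \<in> W \<omega> n}" by (rule finite_subset) simp
    then show ?case by (simp add: W_def)
  qed
qed

lemma AE_finite_windows:
  assumes "antimono a" and "0 < measure (measure_pmf \<mu>) {..m}"
  shows "AE \<omega> in seqs \<mu>. finite_windows m a \<omega>"
  unfolding finite_windows_def AE_all_countable
  using AE_finite_window[OF assms] by simp

lemma tails_unbounded_of_infinite_gap:
  assumes "infinite {n. \<omega> n \<in> gap a k \<omega> n}"
  shows "\<forall>\<^sub>F n in sequentially. enat m \<le> tails a \<omega> n k"
proof -
  obtain N where "m \<le> visits (gap a k) \<omega> N"
    using assms finite_visits_iff[of \<omega> "gap a k"] by (meson nle_le)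
  then have "enat m \<le> tails a \<omega> N k"
    using visits_gap_le_tails[of a k \<omega> N] by (meson enat_ord_simps(1) order_trans)
  then have "enat m \<le> tails a \<omega> n k" if "N \<le> n" for n
    using tails_mono_time[OF that] by (rule order_trans)
  then show ?thesis by (auto simp: eventually_sequentially)
qed

text \<open>The windows are counted only while the tail is at least \<open>m\<close>, so they control the hits above any tail that eventually
  exceeds \<open>m\<close>.\<close>

lemma finite_gap_of_window:
  assumes win: "finite_windows m a \<omega>"
    and ev: "\<forall>\<^sub>F n in sequentially. enat m \<le> tails a \<omega> n k"
    and fin: "a k \<noteq> \<infinity>"
  shows "finite {n. tails a \<omega> n k < enat (\<omega> n) \<and> enat (\<omega> n) \<le> tails a \<omega> n k + enat C}"
proof -
  obtain N where N: "\<And>n. N \<le> n \<Longrightarrow> enat m \<le> tails a \<omega> n k"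
    using ev by (auto simp: eventually_sequentially)
  let ?W = "\<lambda>c. {n. \<exists>t. tails a \<omega> n k = enat t \<and> m \<le> t \<and> \<omega> n = t + c}"
  have "{n. tails a \<omega> n k < enat (\<omega> n) \<and> enat (\<omega> n) \<le> tails a \<omega> n k + enat C} \<subseteq>
      {..<N} \<union> (\<Union>c\<in>{1..C}. ?W c)"
  proof
    fix n assume n: "n \<in> {n. tails a \<omega> n k < enat (\<omega> n) \<and> enat (\<omega> n) \<le> tails a \<omega> n k + enat C}"
    show "n \<in> {..<N} \<union> (\<Union>c\<in>{1..C}. ?W c)"
    proof (cases "n < N")
      case False
      obtain t where t: "tails a \<omega> n k = enat t"
        using fin tails_eq_infinity[of a \<omega> n k] by auto
      have "m \<le> t" using N[of n] False t by simp
      moreover have "t < \<omega> n" "\<omega> n \<le> t + C" using n t by auto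
      ultimately have "n \<in> ?W (\<omega> n - t)" "\<omega> n - t \<in> {1..C}" using t by auto
      then show ?thesis by blast
    qed simp
  qed
  moreover have "finite (\<Union>c\<in>{1..C}. ?W c)"
    using win unfolding finite_windows_def by (intro finite_UN_I) auto
  ultimately show ?thesis by (meson finite_UnI finite_lessThan finite_subset)
qed

text \<open>A bin whose content stays bounded offers only finitely many values that send a ball into the next bin, whence the next bin also
  stays bounded.\<close>

lemma finite_gap_Suc:
  assumes am: "antimono a" and win: "finite_windows m a \<omega>" and fin: "a k \<noteq> \<infinity>"
    and k: "finite {n. \<omega> n \<in> gap a k \<omega> n}"
  shows "finite {n. \<omega> n \<in> gap a (k + 1) \<omega> n}"
proof (rule ccontr)
  assume inf: "infinite {n. \<omega> n \<in> gap a (k + 1) \<omega> n}"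
  obtain B where B: "\<And>n. visits (gap a k) \<omega> n \<le> B"
    using k finite_visits_iff[of \<omega> "gap a k"] by blast
  obtain ak where ak: "a k = enat ak" using fin by auto
  have fin': "a (k + 1) \<noteq> \<infinity>" using antimonoD[OF am, of k "k + 1"] ak by (auto dest: enat_ile)
  then obtain ak' where ak': "a (k + 1) = enat ak'" by auto
  have "tails a \<omega> n k \<le> tails a \<omega> n (k + 1) + enat (ak + B)" for n
  proof -
    have "tails a \<omega> n k + a (k + 1) = tails a \<omega> n (k + 1) + a k + enat (visits (gap a k) \<omega> n)"
      by (rule tails_balance[OF am])
    with B[of n] show ?thesis
      using ak ak' by (cases "tails a \<omega> n k"; cases "tails a \<omega> n (k + 1)") auto
  qed
  then have "{n. \<omega> n \<in> gap a (k + 1) \<omega> n} \<subseteq> {n. tails a \<omega> n (k + 1) < enat (\<omega> n) \<and>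
      enat (\<omega> n) \<le> tails a \<omega> n (k + 1) + enat (ak + B)}"
    by (auto simp: gap_def intro: order_trans)
  with finite_gap_of_window[OF win tails_unbounded_of_infinite_gap[OF inf] fin']
  show False using inf finite_subset by blast
qed

lemma finite_gap_later:
  assumes "antimono a" "finite_windows m a \<omega>" "a k \<noteq> \<infinity>" "finite {n. \<omega> n \<in> gap a k \<omega> n}" "k \<le> l"
  shows "finite {n. \<omega> n \<in> gap a l \<omega> n}"
  using \<open>k \<le> l\<close>
proof (induction l rule: int_ge_induct)
  case (step l)
  have "a l \<noteq> \<infinity>" using antimonoD[OF assms(1) step(1)] assms(3) by (auto dest: enat_ile)
  from finite_gap_Suc[OF assms(1,2) this step(2)] show ?case .
qed (rule assms(4))

text \<open>Two processes that are driven by the same moves and have an infinite bin in common: the tails of a bin to its right can drift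
  apart only when a move falls between the tails of the preceding bin, which are boundedly far apart by induction.\<close>

lemma tails_bounded_difference:
  assumes a: "a p = \<infinity>" "\<And>k. p < k \<Longrightarrow> a k \<noteq> \<infinity>" and b: "b p = \<infinity>" "\<And>k. p < k \<Longrightarrow> b k \<noteq> \<infinity>"
    and win: "finite_windows m b \<omega>" and below: "mostly_below m \<omega>"
    and k: "p \<le> k"
  shows "\<exists>C. \<forall>n. tails a \<omega> n k \<le> tails b \<omega> n k + enat C"
  using k
proof (induction k rule: int_ge_induct)
  case base
  show ?case using b(1) tails_eq_infinity[of b \<omega> _ p] by (intro exI[of _ 0]) simp
next
  case (step k)
  then obtain C where C: "\<And>n. tails a \<omega> n k \<le> tails b \<omega> n k + enat C" by blast
  \<comment> \<open>the times at which the tail of \<open>k + 1\<close> may increase for \<open>a\<close> but not for \<open>b\<close>\<close>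
  define J where "J = {n. tails b \<omega> n k < enat (\<omega> n) \<and> enat (\<omega> n) \<le> tails b \<omega> n k + enat C}"
  have finJ: "finite J"
  proof (cases "p < k")
    case True
    have "\<forall>\<^sub>F n in sequentially. enat m \<le> tails b \<omega> n k"
      using tails_growth[OF below _ True, of b m] b(1)
      by (auto elim!: eventually_mono intro: order_trans[rotated])
    then show ?thesis
      unfolding J_def by (rule finite_gap_of_window[OF win _ b(2)[OF True]])
  next
    case False
    then have "k = p" using step by simp
    then have "J = {}" using b(1) tails_eq_infinity[of b \<omega> _ p] by (auto simp: J_def)
    then show ?thesis by simp
  qed
  obtain a0 where a0: "a (k + 1) = enat a0" using a(2)[of "k + 1"] step by auto
  have "tails a \<omega> n (k + 1) \<le> tails b \<omega> n (k + 1) + enat (a0 + card {i \<in> J. i < n})" for n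
  proof (induction n)
    case 0
    show ?case using a0 by (simp add: add_increasing)
  next
    case (Suc n)
    have "card {i \<in> J. i < Suc n} = card {i \<in> J. i < n} + of_bool (n \<in> J)"
    proof -
      have "{i \<in> J. i < Suc n} = {i \<in> J. i < n} \<union> (if n \<in> J then {n} else {})"
        by (auto simp: less_Suc_eq)
      then show ?thesis using finJ by auto
    qed
    moreover have "of_bool (enat (\<omega> n) \<le> tails a \<omega> n k) \<le>
        (of_bool (enat (\<omega> n) \<le> tails b \<omega> n k) + enat (of_bool (n \<in> J)))"
      using C[of n] by (auto simp: J_def one_enat_def not_le intro: order_trans)
    with Suc have "tails a \<omega> n (k + 1) + of_bool (enat (\<omega> n) \<le> tails a \<omega> n k) \<le>
       tails b \<omega> n (k + 1) + enat (a0 + card {i \<in> J. i < n}) +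
        (of_bool (enat (\<omega> n) \<le> tails b \<omega> n k) + enat (of_bool (n \<in> J)))"
      by (rule add_mono)
    ultimately show ?case
      by (cases "tails b \<omega> n (k + 1)"; cases "tails a \<omega> n (k + 1)") (auto simp: ac_simps zero_enat_def one_enat_def of_bool_def split: if_splits)
  qed
  moreover have "enat (a0 + card {i \<in> J. i < n}) \<le> enat (a0 + card J)" for n
    using finJ by (auto intro: card_mono)
  ultimately have "tails a \<omega> n (k + 1) \<le> tails b \<omega> n (k + 1) + enat (a0 + card J)" for n
    by (meson add_left_mono order_trans)
  then show ?case by blast
qed

text \<open>The content of a bin is the difference of two consecutive tails, each of which is the same for both processes up to a bounded
  error.\<close>

lemma infinite_gap_transfer:
  assumes a: "antimono a" "a p = \<infinity>" "\<And>k. p < k \<Longrightarrow> a k \<noteq> \<infinity>"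
    and b: "antimono b" "b p = \<infinity>" "\<And>k. p < k \<Longrightarrow> b k \<noteq> \<infinity>"
    and win: "finite_windows m a \<omega>" "finite_windows m b \<omega>" and below: "mostly_below m \<omega>"
    and k: "p < k" and inf: "infinite {n. \<omega> n \<in> gap a k \<omega> n}"
  shows "infinite {n. \<omega> n \<in> gap b k \<omega> n}"
proof
  assume "finite {n. \<omega> n \<in> gap b k \<omega> n}"
  then obtain B where B: "\<And>n. visits (gap b k) \<omega> n \<le> B"
    using finite_visits_iff[of \<omega> "gap b k"] by blast
  obtain C where C: "\<And>n. tails a \<omega> n k \<le> tails b \<omega> n k + enat C"
    using tails_bounded_difference[where a=a and b=b and p=p and k=k, OF a(2,3) b(2,3) win(2) below] k by auto
  obtain D where D: "\<And>n. tails b \<omega> n (k + 1) \<le> tails a \<omega> n (k + 1) + enat D"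
    using tails_bounded_difference[where a=b and b=a and p=p and k="k + 1", OF b(2,3) a(2,3) win(1) below] k by auto
  obtain a0 a1 b0 b1 where ab: "a k = enat a0" "a (k + 1) = enat a1" "b k = enat b0" "b (k + 1) = enat b1"
    using a(3)[of k] a(3)[of "k + 1"] b(3)[of k] b(3)[of "k + 1"] k by auto
  have "visits (gap a k) \<omega> n \<le> C + D + b0 + B + a1" for n
  proof -
    have fin: "tails a \<omega> n k \<noteq> \<infinity>" "tails a \<omega> n (k + 1) \<noteq> \<infinity>" "tails b \<omega> n k \<noteq> \<infinity>" "tails b \<omega> n (k + 1) \<noteq> \<infinity>"
      by (simp_all add: tails_eq_infinity ab)
    then obtain s s' t t' where st: "tails a \<omega> n k = enat s" "tails a \<omega> n (k + 1) = enat s'"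
      "tails b \<omega> n k = enat t" "tails b \<omega> n (k + 1) = enat t'" by auto
    from tails_balance[OF a(1), of \<omega> n k] tails_balance[OF b(1), of \<omega> n k] C[of n] D[of n] B[of n]
    show ?thesis by (simp add: st ab)
  qed
  with inf show False using finite_visits_iff[of \<omega> "gap a k"] by blast
qed

section \<open>Transfer between probability spaces\<close>

text \<open>An i.i.d. sequence pushes its probability space forward to the sequence space.\<close>

lemma AE_iid:
  assumes iid: "iid_with_law M \<xi> \<mu>" and ae: "AE \<omega> in seqs \<mu>. P \<omega>"
  shows "AE \<omega> in M. P (\<lambda>n. \<xi> n \<omega>)"
proof -
  interpret prob_space M using iid by (simp add: iid_with_law_def)
  have ind: "indep_vars (\<lambda>_. count_space UNIV) \<xi> UNIV"
    and law: "\<And>n. distr M (count_space UNIV) (\<xi> n) = measure_pmf \<mu>"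
    using iid by (auto simp: iid_with_law_def)
  have rv: "\<And>n. random_variable (count_space UNIV) (\<xi> n)"
    using ind by (simp add: indep_vars_def)
  have sets_eq: "sets (\<Pi>\<^sub>M n\<in>(UNIV :: nat set). count_space UNIV) = sets (seqs \<mu>)"
    by (intro sets_PiM_cong) auto
  have m: "(\<lambda>\<omega> n. \<xi> n \<omega>) \<in> measurable M (\<Pi>\<^sub>M n\<in>(UNIV :: nat set). count_space UNIV)"
    by (rule measurable_PiM_single') (use rv in auto)
  have eq: "distr M (\<Pi>\<^sub>M n\<in>UNIV. count_space UNIV) (\<lambda>\<omega> n. \<xi> n \<omega>) = seqs \<mu>"
    using indep_vars_iff_distr_eq_PiM'[where I=UNIV and X=\<xi> and M'="\<lambda>_. count_space UNIV"] ind rv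
    by (simp add: law restrict_UNIV)
  have "AE \<omega> in distr M (\<Pi>\<^sub>M n\<in>UNIV. count_space UNIV) (\<lambda>\<omega> n. \<xi> n \<omega>). P \<omega>"
    unfolding eq by (rule ae)
  then show ?thesis by (rule AE_distrD[OF m])
qed

lemma AE_seqs_positive:
  assumes "set_pmf \<mu> \<subseteq> {1..}" shows "AE \<omega> in seqs \<mu>. \<forall>n. 1 \<le> \<omega> n"
  unfolding AE_all_countable
proof
  fix n
  interpret P: product_prob_space "\<lambda>_. measure_pmf \<mu>" "UNIV :: nat set" by unfold_locales
  have "AE x in measure_pmf \<mu>. 1 \<le> x" using assms by (auto simp: AE_measure_pmf_iff)
  then have "AE x in distr (seqs \<mu>) (measure_pmf \<mu>) (\<lambda>\<omega>. \<omega> n). 1 \<le> x"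
    by (subst P.PiM_component) simp
  then show "AE \<omega> in seqs \<mu>. 1 \<le> \<omega> n"
    by (rule AE_distrD[rotated]) simp
qed

section \<open>Explosion for measures of infinite type\<close>

lemma configsI:
  assumes "X p \<noteq> 0" "\<forall>j>p. X j = 0" shows "X \<in> configs"
proof -
  have "(SUP j\<in>{j. X j \<noteq> 0}. ereal (of_int j)) = ereal (of_int p)"
    using assms by (intro antisym SUP_least SUP_upper) (auto simp: not_less[symmetric])
  then show ?thesis by (simp add: configs_def)
qed

text \<open>The tails of a single infinite bin at \<open>p\<close>.\<close>

definition half_line :: "int \<Rightarrow> int \<Rightarrow> enat" where
  "half_line p k = (if k \<le> p then \<infinity> else 0)"

lemma antimono_half_line: "antimono (half_line p)"
  by (auto simp: antimono_def half_line_def)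

lemma hat_config_in_configs: "hat_config \<in> configs"
  by (rule configsI[of _ 0]) (auto simp: hat_config_def)

lemma tail_hat_config: "tail hat_config = half_line 0"
proof
  fix k :: int
  have "tail hat_config k = sum hat_config {k..0}"
    by (rule tail_eq_sum) (simp add: hat_config_def)
  also have "\<dots> = half_line 0 k"
    by (auto simp: half_line_def hat_config_def if_distrib sum.delta)
  finally show "tail hat_config k = half_line 0 k" .
qed

lemma gap_shift: "gap (\<lambda>k. a (k - p)) k = gap a (k - p)"
proof -
  have "tails (\<lambda>k. a (k - p)) \<omega> n k = tails a \<omega> n (k - p)" for \<omega> n k
    by (induction n arbitrary: k) (auto simp: algebra_simps)
  then show ?thesis by (auto simp: gap_def algebra_simps fun_eq_iff)
qed

lemma gap_half_line: "gap (half_line p) k = gap (half_line 0) (k - p)"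
proof -
  have "half_line p = (\<lambda>k. half_line 0 (k - p))" by (auto simp: half_line_def)
  then show ?thesis using gap_shift[of "half_line 0" p k] by simp
qed

lemma ibm_limit_hat_infinite_iff:
  assumes "\<forall>n. 1 \<le> \<omega> n" "1 \<le> k"
  shows "ibm_limit hat_config \<omega> k = \<infinity> \<longleftrightarrow> infinite {n. \<omega> n \<in> gap (half_line 0) k \<omega> n}"
  using ibm_limit_infinite_iff[OF hat_config_in_configs assms(1), of k] assms(2)
  by (simp add: tail_hat_config) (simp add: hat_config_def)

lemma AE_infinite_type:
  assumes "set_pmf \<mu> \<subseteq> {1..}" "infinite_type \<mu>"
  shows "AE \<omega> in seqs \<mu>. \<forall>k>p. infinite {n. \<omega> n \<in> gap (half_line p) k \<omega> n}"
proof -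
  have "AE \<omega> in seqs \<mu>. \<infinity> = (INF k\<in>{k. 1 \<le> k \<and> ibm_limit hat_config \<omega> (int k) < \<infinity>}. enat k)"
    using assms(2) by (simp add: infinite_type_def of_type_def)
  with AE_seqs_positive[OF assms(1)] show ?thesis
  proof eventually_elim
    case (elim \<omega>)
    show ?case
    proof (intro allI impI)
      fix k assume k: "p < k"
      have "ibm_limit hat_config \<omega> (k - p) = \<infinity>"
      proof (rule ccontr)
        assume "ibm_limit hat_config \<omega> (k - p) \<noteq> \<infinity>"
        then have "(INF k\<in>{k. 1 \<le> k \<and> ibm_limit hat_config \<omega> (int k) < \<infinity>}. enat k) \<le> enat (nat (k - p))"
          using k by (intro INF_lower) auto
        with elim(2) show False by (metis enat_ord_simps(5) not_enat_eq enat.distinct(1) enat_ile)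
      qed
      then show "infinite {n. \<omega> n \<in> gap (half_line p) k \<omega> n}"
        using ibm_limit_hat_infinite_iff[OF elim(1), of "k - p"] k by (simp add: gap_half_line[of p k])
    qed
  qed
qed

definition piles :: "(nat \<Rightarrow> nat) \<Rightarrow> config" where
  "piles a k = (if k \<le> 0 then enat (a (nat (- k))) else 0)"

definition pile_tail :: "(nat \<Rightarrow> nat) \<Rightarrow> int \<Rightarrow> enat" where
  "pile_tail a k = enat (\<Sum>i<nat (1 - k). a i)"

text \<open>The tails of the piles after bin \<open>- j\<close> has been made infinite; they depend only on the piles
  \<open>a 0, \<dots>, a (j - 1)\<close>.\<close>

definition filled_tail :: "nat \<Rightarrow> (nat \<Rightarrow> nat) \<Rightarrow> int \<Rightarrow> enat" where
  "filled_tail j a k = (if k \<le> - int j then \<infinity> else pile_tail a k)"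

lemma tail_piles: "tail (piles a) = pile_tail a"
proof
  fix k :: int
  have "tail (piles a) k = sum (piles a) {k..0}"
    by (rule tail_eq_sum) (simp add: piles_def)
  also have "\<dots> = (\<Sum>i<nat (1 - k). enat (a i))"
    by (rule sum.reindex_bij_witness[where i="\<lambda>i. - int i" and j="\<lambda>k. nat (- k)"])
      (auto simp: piles_def)
  also have "\<dots> = pile_tail a k"
    by (simp add: pile_tail_def of_nat_eq_enat[symmetric])
  finally show "tail (piles a) k = pile_tail a k" .
qed

lemma antimono_pile_tail: "antimono (pile_tail a)"
  unfolding pile_tail_def by (intro antimonoI) (auto intro!: sum_mono2)

lemma antimono_filled_tail: "antimono (filled_tail j a)"
  using antimonoD[OF antimono_pile_tail[of a]]
  by (intro antimonoI) (auto simp: filled_tail_def)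

lemma filled_tail_cong:
  assumes "\<And>i. i < j \<Longrightarrow> a i = b i" shows "filled_tail j a = filled_tail j b"
proof
  fix k
  have "(\<Sum>i<nat (1 - k). a i) = (\<Sum>i<nat (1 - k). b i)" if "- int j < k"
    using that by (intro sum.cong assms) auto
  then show "filled_tail j a k = filled_tail j b k"
    by (auto simp: filled_tail_def pile_tail_def)
qed

text \<open>As long as no move exceeds \<open>a j\<close>, the pile in bin \<open>- j\<close> acts like an infinite bin.\<close>

lemma tails_filled:
  assumes "\<forall>i<T. \<omega> i \<le> a j" "n \<le> T" "- int j < k"
  shows "tails (pile_tail a) \<omega> n k = tails (filled_tail j a) \<omega> n k \<and>
    visits (gap (pile_tail a) k) \<omega> n = visits (gap (filled_tail j a) k) \<omega> n"
  using assms(2,3)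
proof (induction n arbitrary: k)
  case 0
  then show ?case by (simp add: filled_tail_def)
next
  case (Suc n)
  have big: "enat (\<omega> n) \<le> tails (pile_tail a) \<omega> n (- int j)"
  proof -
    have "\<omega> n \<le> a j" using assms(1) Suc.prems by simp
    also have "a j \<le> (\<Sum>i<Suc j. a i)" by simp
    finally have "enat (\<omega> n) \<le> pile_tail a (- int j)"
      by (simp add: pile_tail_def nat_add_distrib)
    then show ?thesis using tails_initial_le by (rule order_trans)
  qed
  have prev: "enat (\<omega> n) \<le> tails (pile_tail a) \<omega> n (k - 1) \<longleftrightarrow>
      enat (\<omega> n) \<le> tails (filled_tail j a) \<omega> n (k - 1)"
  proof (cases "- int j < k - 1")
    case True
    then show ?thesis using Suc by simp
  next
    case False
    then have k: "k - 1 = - int j" using Suc.prems by simp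
    have "tails (filled_tail j a) \<omega> n (- int j) = \<infinity>"
      by (simp add: tails_eq_infinity filled_tail_def)
    then show ?thesis unfolding k using big by simp
  qed
  then show ?case
    using Suc by (simp add: visits_Suc gap_def[of _ _ \<omega> n])
qed

text \<open>The bound \<open>A\<close> on the moves before \<open>T\<close> is what makes a pile of \<open>A\<close> balls in bin
  \<open>- j\<close> as good as an infinite bin up to time \<open>T\<close> (\<open>tails_filled\<close>).\<close>

definition fills :: "nat \<Rightarrow> (nat \<Rightarrow> nat) \<Rightarrow> nat \<Rightarrow> (nat \<Rightarrow> nat) \<Rightarrow> bool" where
  "fills j a A \<omega> \<longleftrightarrow> (\<exists>T. (\<forall>i<T. \<omega> i \<le> A) \<and>
     (\<forall>k\<in>{- int j<..<int j}. j \<le> visits (gap (filled_tail j a) k) \<omega> T))"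

lemma fills_cong:
  assumes "\<And>i. i < j \<Longrightarrow> a i = b i" shows "fills j a = fills j b"
proof -
  have "filled_tail j a = filled_tail j b" using assms by (rule filled_tail_cong)
  then show ?thesis by (intro ext) (simp add: fills_def)
qed

lemma sets_fills: "{\<omega>. \<not> fills j a A \<omega>} \<in> sets (seqs \<mu>)"
proof -
  let ?Q = "\<lambda>T \<omega>. (\<forall>i<T. \<omega> i \<le> A) \<and>
     (\<forall>k\<in>{- int j<..<int j}. j \<le> visits (gap (filled_tail j a) k) \<omega> T)"
  have "adapted T (?Q T)" for T
    unfolding adapted_def
  proof (intro allI impI)
    fix \<omega> \<omega>' :: "nat \<Rightarrow> nat" assume eq: "\<forall>i<T. \<omega> i = \<omega>' i"
    then have "visits (gap (filled_tail j a) k) \<omega> T = visits (gap (filled_tail j a) k) \<omega>' T" for k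
      by (intro adaptedD[OF adapted_visits[OF adapted_gap]]) simp
    with eq show "?Q T \<omega> = ?Q T \<omega>'" by simp
  qed
  then have "(\<Union>T. {\<omega>. ?Q T \<omega>}) \<in> sets (seqs \<mu>)"
    by (intro sets.countable_UN) (auto intro: sets_adapted)
  then have "space (seqs \<mu>) - (\<Union>T. {\<omega>. ?Q T \<omega>}) \<in> sets (seqs \<mu>)" by (rule sets.compl_sets)
  moreover have "space (seqs \<mu>) - (\<Union>T. {\<omega>. ?Q T \<omega>}) = {\<omega>. \<not> fills j a A \<omega>}"
    by (auto simp: fills_def)
  ultimately show ?thesis by simp
qed

text \<open>The process with an infinite bin at \<open>- j\<close> and further piles to its right has the same infinite bins as the process
  with the infinite bin alone, in which all of them are infinite by the type of \<open>\<mu>\<close>.\<close>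

lemma AE_fills:
  assumes "set_pmf \<mu> \<subseteq> {1..}" "infinite_type \<mu>"
  shows "AE \<omega> in seqs \<mu>. \<exists>A. fills j a A \<omega>"
proof -
  let ?p = "- int j"
  obtain m where m: "7 / 8 \<le> measure (measure_pmf \<mu>) {..m}" by (rule exists_typical_bound)
  then have m0: "0 < measure (measure_pmf \<mu>) {..m}" by linarith
  from AE_infinite_type[OF assms, of ?p] AE_mostly_below[OF m]
    AE_finite_windows[OF antimono_half_line m0, of ?p] AE_finite_windows[OF antimono_filled_tail m0, of j a]
  show ?thesis
  proof eventually_elim
    case (elim \<omega>)
    have inf: "infinite {n. \<omega> n \<in> gap (filled_tail j a) k \<omega> n}" if "?p < k" for k
    proof (rule infinite_gap_transfer[where a="half_line ?p" and p="?p" and m=m])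
      show "infinite {n. \<omega> n \<in> gap (half_line ?p) k \<omega> n}" using elim(1) that by simp
    qed (use elim that in \<open>auto simp: antimono_half_line antimono_filled_tail half_line_def filled_tail_def pile_tail_def\<close>)
    have "\<forall>\<^sub>F T in sequentially. j \<le> visits (gap (filled_tail j a) k) \<omega> T" if "?p < k" for k
    proof -
      have "infinite {n. \<omega> n \<in> gap (filled_tail j a) k \<omega> n}" by (rule inf[OF that])
      then obtain N where "j \<le> visits (gap (filled_tail j a) k) \<omega> N"
        using finite_visits_iff[of \<omega> "gap (filled_tail j a) k"] by (meson nle_le)
      then have "j \<le> visits (gap (filled_tail j a) k) \<omega> T" if "N \<le> T" for T
        using visits_mono[OF that] by (rule order_trans)
      then show ?thesis unfolding eventually_sequentially by blast
    qed
    then have "\<forall>\<^sub>F T in sequentially. \<forall>k\<in>{?p<..<int j}. j \<le> visits (gap (filled_tail j a) k) \<omega> T"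
      by (intro eventually_ball_finite) auto
    then obtain T where T: "\<forall>k\<in>{?p<..<int j}. j \<le> visits (gap (filled_tail j a) k) \<omega> T"
      using eventually_happens'[OF sequentially_bot] by blast
    have "\<forall>i<T. \<omega> i \<le> (\<Sum>i<T. \<omega> i)"
      by (auto intro: member_le_sum)
    with T show ?case unfolding fills_def by blast
  qed
qed

lemma exists_pile_size:
  assumes "set_pmf \<mu> \<subseteq> {1..}" "infinite_type \<mu>" "0 < \<epsilon>"
  shows "\<exists>A\<ge>1. measure (seqs \<mu>) {\<omega>. \<not> fills j a A \<omega>} \<le> \<epsilon>"
proof -
  interpret S: prob_space "seqs \<mu>" by (rule prob_space_seqs)
  let ?B = "\<lambda>A. {\<omega>. \<not> fills j a A \<omega>}"
  have "decseq ?B"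
    unfolding decseq_def fills_def by (auto intro: order_trans) (meson order_trans)
  then have "(\<lambda>A. measure (seqs \<mu>) (?B A)) \<longlonglongrightarrow> measure (seqs \<mu>) (\<Inter>A. ?B A)"
    by (intro S.finite_Lim_measure_decseq) (auto intro: sets_fills)
  moreover have "measure (seqs \<mu>) (\<Inter>A. ?B A) = 0"
  proof -
    have "(\<Inter>A. ?B A) \<in> sets (seqs \<mu>)" by (intro sets.countable_INT) (auto intro: sets_fills)
    moreover have "AE \<omega> in seqs \<mu>. \<omega> \<notin> (\<Inter>A. ?B A)"
      using AE_fills[OF assms(1,2), of j a] by eventually_elim auto
    ultimately show ?thesis using S.prob_eq_0 by simp
  qed
  ultimately have "\<forall>\<^sub>F A in sequentially. measure (seqs \<mu>) (?B A) < \<epsilon>"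
    using assms(3) by (intro order_tendstoD(2)) auto
  then have "\<forall>\<^sub>F A in sequentially. measure (seqs \<mu>) (?B A) \<le> \<epsilon> \<and> 1 \<le> A"
    using eventually_ge_at_top[of 1] by eventually_elim auto
  then show ?thesis by (metis (mono_tags, lifting) eventually_happens' sequentially_bot)
qed

text \<open>The pile \<open>j\<close> is chosen by \<open>g\<close> from the piles before it; the piles from \<open>j\<close> on are still
  \<open>0\<close> at stage \<open>j\<close>.\<close>

primrec choose_piles :: "(nat \<Rightarrow> (nat \<Rightarrow> nat) \<Rightarrow> nat) \<Rightarrow> nat \<Rightarrow> nat \<Rightarrow> nat" where
  "choose_piles g 0 = (\<lambda>_. 0)"
| "choose_piles g (Suc j) = fun_upd (choose_piles g j) j (g j (choose_piles g j))"

lemma exists_pile_sizes: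
  assumes "set_pmf \<mu> \<subseteq> {1..}" "infinite_type \<mu>"
  shows "\<exists>a. \<forall>j. 1 \<le> a j \<and> measure (seqs \<mu>) {\<omega>. \<not> fills j a (a j) \<omega>} \<le> (1 / 2) ^ j"
proof -
  have "\<forall>j f. \<exists>A\<ge>1. measure (seqs \<mu>) {\<omega>. \<not> fills j f A \<omega>} \<le> (1 / 2) ^ j"
    using exists_pile_size[OF assms] by simp
  then obtain g where g: "\<And>j f. 1 \<le> g j f \<and> measure (seqs \<mu>) {\<omega>. \<not> fills j f (g j f) \<omega>} \<le> (1 / 2) ^ j"
    by metis
  define a where "a = (\<lambda>i. g i (choose_piles g i))"
  have pre: "choose_piles g j i = a i" if "i < j" for i j
    using that by (induction j) (auto simp: a_def less_Suc_eq)
  have "1 \<le> a j \<and> measure (seqs \<mu>) {\<omega>. \<not> fills j a (a j) \<omega>} \<le> (1 / 2) ^ j" for j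
  proof -
    have "fills j (choose_piles g j) = fills j a" by (rule fills_cong) (rule pre)
    with g[of j "choose_piles g j"] show ?thesis by (simp add: a_def)
  qed
  then show ?thesis by blast
qed

lemma infinite_type_explosion:
  assumes pos: "set_pmf \<mu> \<subseteq> {1..}" and inf: "infinite_type \<mu>"
  obtains X0 where "X0 \<in> configs" "locally_finite X0"
    "AE \<omega> in seqs \<mu>. \<forall>k. ibm_limit X0 \<omega> k = \<infinity>"
proof -
  interpret S: prob_space "seqs \<mu>" by (rule prob_space_seqs)
  obtain a where a: "\<And>j. 1 \<le> a j" "\<And>j. measure (seqs \<mu>) {\<omega>. \<not> fills j a (a j) \<omega>} \<le> (1 / 2) ^ j"
    using exists_pile_sizes[OF assms] by blast
  have conf: "piles a \<in> configs"
    by (rule configsI[of _ 0]) (use a(1)[of 0] in \<open>auto simp: piles_def zero_enat_def\<close>)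
  have lf: "locally_finite (piles a)"
    by (simp add: locally_finite_def piles_def zero_enat_def)
  have "summable (\<lambda>j. measure (seqs \<mu>) {\<omega>. \<not> fills j a (a j) \<omega>})"
    by (rule summable_comparison_test'[OF summable_geometric[of "1 / 2 :: real"], where N=0]) (use a in auto)
  then have "AE \<omega> in seqs \<mu>. eventually (\<lambda>j. \<omega> \<in> space (seqs \<mu>) - {\<omega>. \<not> fills j a (a j) \<omega>}) sequentially"
    by (intro borel_cantelli_AE1 sets_fills) (auto simp: S.emeasure_eq_measure)
  with AE_seqs_positive[OF pos] have "AE \<omega> in seqs \<mu>. \<forall>k. ibm_limit (piles a) \<omega> k = \<infinity>"
  proof eventually_elim
    case (elim \<omega>)
    then obtain J where J: "\<And>j. J \<le> j \<Longrightarrow> fills j a (a j) \<omega>" by (auto simp: eventually_sequentially)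
    show ?case
    proof
      fix k
      have "\<exists>n. B < visits (gap (pile_tail a) k) \<omega> n" for B
      proof -
        define j where "j = Suc (max B (max J (nat \<bar>k\<bar>)))"
        have j: "B < j" "J \<le> j" "k \<in> {- int j<..<int j}" by (auto simp: j_def)
        from J[OF j(2)] obtain T where T: "\<forall>i<T. \<omega> i \<le> a j" "j \<le> visits (gap (filled_tail j a) k) \<omega> T"
          unfolding fills_def using j(3) by blast
        have "visits (gap (pile_tail a) k) \<omega> T = visits (gap (filled_tail j a) k) \<omega> T"
          using tails_filled[of T \<omega> a j T k] T(1) j(3) by simp
        with T(2) j(1) show ?thesis by (metis order_less_le_trans)
      qed
      then have "infinite {n. \<omega> n \<in> gap (pile_tail a) k \<omega> n}"
        unfolding finite_visits_iff by (meson not_le)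
      then show "ibm_limit (piles a) \<omega> k = \<infinity>"
        using ibm_limit_infinite_iff[OF conf elim(1), of k] by (simp add: tail_piles)
    qed
  qed
  with conf lf that show ?thesis by blast
qed

section \<open>A lower bound for visits in probability\<close>

lemma weighted_average_tendsto_0:
  fixes w e :: "nat \<Rightarrow> real"
  assumes e: "e \<longlonglongrightarrow> 0" and w: "\<And>n. 0 \<le> w n"
    and div: "filterlim (\<lambda>n. \<Sum>i<n. w i) at_top sequentially" and \<delta>: "0 < \<delta>"
  shows "\<forall>\<^sub>F n in sequentially. (\<Sum>i<n. w i * e i) \<le> \<delta> * (\<Sum>i<n. w i)"
proof -
  have "\<forall>\<^sub>F n in sequentially. e n < \<delta> / 2"
    using e \<delta> by (intro order_tendstoD(2)) auto
  then obtain N where N: "\<And>n. N \<le> n \<Longrightarrow> e n < \<delta> / 2" by (auto simp: eventually_sequentially)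
  define K where "K = (\<Sum>i<N. w i * e i) - \<delta> / 2 * (\<Sum>i<N. w i)"
  have le: "(\<Sum>i<n. w i * e i) \<le> K + \<delta> / 2 * (\<Sum>i<n. w i)" if "N \<le> n" for n
    using that
  proof (induction n rule: dec_induct)
    case (step n)
    have "w n * e n \<le> w n * (\<delta> / 2)" using N[OF step(1)] w[of n] by (intro mult_left_mono) auto
    with step(3) show ?case by (simp add: algebra_simps)
  qed (simp add: K_def)
  have "\<forall>\<^sub>F n in sequentially. 2 * K / \<delta> \<le> (\<Sum>i<n. w i)"
    using div by (simp add: filterlim_at_top)
  with eventually_ge_at_top[of N] show ?thesis
  proof eventually_elim
    case (elim n)
    from elim(2) \<delta> have "K \<le> \<delta> / 2 * (\<Sum>i<n. w i)" by (simp add: field_simps)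
    with le[OF elim(1)] show ?case by simp
  qed
qed

text \<open>The times \<open>i\<close> at which the conditional probability fails to reach \<open>c * w i\<close> carry in expectation a
  vanishing fraction of the total weight, as a weighted average of probabilities that tend to \<open>0\<close>. So by Markov's
  inequality the compensator is at least \<open>c / 2\<close> times the total weight with probability tending to one, and then
  few visits are exponentially unlikely.\<close>

lemma visits_lower_bound:
  fixes w :: "nat \<Rightarrow> real"
  assumes W: "\<And>i. adapted i (\<lambda>\<omega>. W \<omega> i)" and w: "\<And>n. 0 \<le> w n" and c: "0 < c"
    and div: "filterlim (\<lambda>n. \<Sum>i<n. w i) at_top sequentially"
    and lim: "(\<lambda>n. measure (seqs \<mu>) {\<omega>. measure (measure_pmf \<mu>) (W \<omega> n) < c * w n}) \<longlonglongrightarrow> 0"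
  shows "(\<lambda>n. measure (seqs \<mu>) {\<omega>. visits W \<omega> n < c / 8 * (\<Sum>i<n. w i)}) \<longlonglongrightarrow> 0"
proof -
  interpret S: prob_space "seqs \<mu>" by (rule prob_space_seqs)
  define b where "b = (\<lambda>n. \<Sum>i<n. w i)"
  define D where "D = (\<lambda>n. {\<omega>. measure (measure_pmf \<mu>) (W \<omega> n) < c * w n})"
  \<comment> \<open>the weight of the times at which the conditional probability is too small\<close>
  define V where "V = (\<lambda>n \<omega>. \<Sum>i<n. w i * indicator (D i) \<omega>)"
  have adD: "adapted n (\<lambda>\<omega>. \<omega> \<in> D n)" for n
    unfolding D_def mem_Collect_eq by (rule adapted_compose[OF W, where h="\<lambda>B. measure (measure_pmf \<mu>) B < c * w n"])
  have setD: "D n \<in> sets (seqs \<mu>)" for n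
    using sets_adapted[OF adD[of n]] by simp
  have adV: "adapted n (V n)" for n
  proof (induction n)
    case 0 show ?case by (simp add: V_def adapted_def)
  next
    case (Suc n)
    have "adapted (Suc n) (\<lambda>\<omega>. V n \<omega> + w n * of_bool (\<omega> \<in> D n))"
      by (rule adapted_compose2[OF adapted_mono[OF Suc] adapted_mono[OF adD]]) auto
    moreover have "V (Suc n) = (\<lambda>\<omega>. V n \<omega> + w n * of_bool (\<omega> \<in> D n))"
      by (rule ext) (simp only: V_def sum.lessThan_Suc indicator_def)
    ultimately show ?case by simp
  qed
  have intD: "integrable (seqs \<mu>) (\<lambda>\<omega>. w i * indicator (D i) \<omega>)" for i
    using setD by (intro integrable_mult_right integrable_real_indicator) (auto simp: S.emeasure_eq_measure)
  have V0: "0 \<le> V n \<omega>" for n \<omega> unfolding V_def using w by (intro sum_nonneg) auto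
  have EV: "(\<integral>\<omega>. V n \<omega> \<partial>seqs \<mu>) = (\<Sum>i<n. w i * measure (seqs \<mu>) (D i))" for n
    unfolding V_def using intD setD by (subst Bochner_Integration.integral_sum) auto
  have bad: "\<forall>\<^sub>F n in sequentially. measure (seqs \<mu>) {\<omega>. b n / 2 \<le> V n \<omega>} \<le> \<delta>" if "0 < \<delta>" for \<delta>
  proof -
    have "\<forall>\<^sub>F n in sequentially. (\<Sum>i<n. w i * measure (seqs \<mu>) (D i)) \<le> \<delta> / 2 * (\<Sum>i<n. w i)"
      using that lim by (intro weighted_average_tendsto_0 w div) (auto simp: D_def)
    moreover have "\<forall>\<^sub>F n in sequentially. 0 < b n"
      using div unfolding b_def by (rule filterlim_at_top_dense[THEN iffD1, rule_format])
    ultimately show ?thesis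
    proof eventually_elim
      case (elim n)
      have "measure (seqs \<mu>) {\<omega> \<in> space (seqs \<mu>). b n / 2 \<le> V n \<omega>} \<le> (\<integral>\<omega>. V n \<omega> \<partial>seqs \<mu>) / (b n / 2)"
      proof (rule integral_Markov_inequality_measure[where A="{}"])
        show "integrable (seqs \<mu>) (V n)" unfolding V_def using intD by (intro Bochner_Integration.integrable_sum)
      qed (use V0 elim in auto)
      also have "\<dots> \<le> \<delta>"
        using elim unfolding EV b_def by (simp add: field_simps)
      finally show ?case by simp
    qed
  qed
  have rare: "measure (seqs \<mu>) {\<omega>. visits W \<omega> n < c / 8 * b n \<and> V n \<omega> < b n / 2} \<le> exp (- (c / 8 * b n))" for n
  proof (rule measure_exponential_bound[where W=W and l="-1"])
    show "adapted n (\<lambda>\<omega>. visits W \<omega> n < c / 8 * b n \<and> V n \<omega> < b n / 2)"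
      by (rule adapted_compose2[OF adapted_visits[OF W] adV, where h="\<lambda>x y. real x < c / 8 * b n \<and> y < b n / 2"])
    fix \<omega> assume \<omega>: "visits W \<omega> n < c / 8 * b n \<and> V n \<omega> < b n / 2"
    have "c * (b n - V n \<omega>) = (\<Sum>i<n. c * (w i - w i * indicator (D i) \<omega>))"
      unfolding b_def V_def sum_subtractf[symmetric] by (rule sum_distrib_left)
    also have "\<dots> \<le> compensator \<mu> W \<omega> n"
      unfolding compensator_def by (intro sum_mono) (auto simp: D_def indicator_def)
    finally have comp: "c * (b n - V n \<omega>) \<le> compensator \<mu> W \<omega> n" .
    have "c * (b n / 2) \<le> c * (b n - V n \<omega>)" using \<omega> c by (intro mult_left_mono) auto
    with comp have comp2: "c * b n / 2 \<le> compensator \<mu> W \<omega> n" by simp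
    have "exp (-1) \<le> (1 / 2 :: real)"
      using exp_ge_add_one_self[of 1] by (simp add: exp_minus field_simps)
    then have "1 / 2 * compensator \<mu> W \<omega> n \<le> (1 - exp (-1)) * compensator \<mu> W \<omega> n"
      by (intro mult_right_mono) (auto simp: compensator_def sum_nonneg)
    with comp2 \<omega> show "c / 8 * b n \<le> -1 * real (visits W \<omega> n) - (exp (-1) - 1) * compensator \<mu> W \<omega> n"
      by (simp add: algebra_simps)
  qed (rule W)
  show ?thesis
  proof (rule tendsto_sandwich[OF _ _ tendsto_const])
    show "(\<lambda>n. measure (seqs \<mu>) {\<omega>. b n / 2 \<le> V n \<omega>} + exp (- (c / 8 * b n))) \<longlonglongrightarrow> 0"
    proof -
      have t1: "(\<lambda>n. measure (seqs \<mu>) {\<omega>. b n / 2 \<le> V n \<omega>}) \<longlonglongrightarrow> 0"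
      proof (rule order_tendstoI)
        fix x :: real assume "0 < x"
        then show "\<forall>\<^sub>F n in sequentially. measure (seqs \<mu>) {\<omega>. b n / 2 \<le> V n \<omega>} < x"
          using bad[of "x / 2"] by (auto elim!: eventually_mono)
      next
        fix x :: real assume "x < 0"
        then show "\<forall>\<^sub>F n in sequentially. x < measure (seqs \<mu>) {\<omega>. b n / 2 \<le> V n \<omega>}"
          by (auto intro!: always_eventually intro: less_le_trans)
      qed
      have t2: "(\<lambda>n. exp (- (c / 8 * b n))) \<longlonglongrightarrow> 0"
      proof -
        have "filterlim (\<lambda>n. c / 8 * b n) at_top sequentially"
          using c div unfolding b_def by (intro filterlim_tendsto_pos_mult_at_top[OF tendsto_const]) auto
        then have "filterlim (\<lambda>n. - (c / 8 * b n)) at_bot sequentially"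
          by (simp add: filterlim_uminus_at_top)
        then show ?thesis by (rule filterlim_compose[OF exp_at_bot])
      qed
      from tendsto_add[OF t1 t2] show ?thesis by simp
    qed
    show "\<forall>\<^sub>F n in sequentially. measure (seqs \<mu>) {\<omega>. visits W \<omega> n < c / 8 * (\<Sum>i<n. w i)} \<le>
        measure (seqs \<mu>) {\<omega>. b n / 2 \<le> V n \<omega>} + exp (- (c / 8 * b n))"
    proof (intro always_eventually allI)
      fix n
      let ?A = "{\<omega>. b n / 2 \<le> V n \<omega>}" and ?B = "{\<omega>. visits W \<omega> n < c / 8 * b n \<and> V n \<omega> < b n / 2}"
      have A: "?A \<in> sets (seqs \<mu>)"
        by (rule sets_adapted[OF adapted_compose[OF adV]])
      have B: "?B \<in> sets (seqs \<mu>)"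
        by (rule sets_adapted[OF adapted_compose2[OF adapted_visits[OF W] adV, where h="\<lambda>x y. real x < c / 8 * b n \<and> y < b n / 2"]])
      have "measure (seqs \<mu>) {\<omega>. visits W \<omega> n < c / 8 * (\<Sum>i<n. w i)} \<le> measure (seqs \<mu>) (?A \<union> ?B)"
        using A B by (intro S.finite_measure_mono sets.Un) (auto simp: b_def)
      also have "\<dots> \<le> measure (seqs \<mu>) ?A + measure (seqs \<mu>) ?B"
        using A B by (rule measure_Un_le)
      finally show "measure (seqs \<mu>) {\<omega>. visits W \<omega> n < c / 8 * (\<Sum>i<n. w i)} \<le>
        measure (seqs \<mu>) ?A + exp (- (c / 8 * b n))"
        using rare[of n] by linarith
    qed
  qed (auto intro!: always_eventually)
qed

section \<open>Bounded growth for measures of finite type\<close>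

text \<open>Level \<open>0\<close> models the content of the bin after an infinite one and level \<open>j + 1\<close> that of the bin after
  level \<open>j\<close>, when the tails have the order of magnitude \<open>s n\<close> at time \<open>n\<close>. The constant
  \<open>c\<close> absorbs the initial contents. Tails are at most \<open>n\<close> to the right of a single infinite bin, which
  gives the lower bound with \<open>s n = n\<close>; in general they are at least \<open>n div 2\<close>, which gives the
  upper bound.\<close>

fun profile :: "nat pmf \<Rightarrow> (nat \<Rightarrow> nat) \<Rightarrow> real \<Rightarrow> nat \<Rightarrow> nat \<Rightarrow> real" where
  "profile \<mu> s c j 0 = c"
| "profile \<mu> s c 0 (Suc n) = profile \<mu> s c 0 n + measure (measure_pmf \<mu>) {s n<..}"
| "profile \<mu> s c (Suc j) (Suc n) = profile \<mu> s c (Suc j) n + profile \<mu> s c j n * pmf \<mu> (s n)"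

abbreviation growth :: "nat pmf \<Rightarrow> nat \<Rightarrow> nat \<Rightarrow> real" where
  "growth \<mu> \<equiv> profile \<mu> (\<lambda>n. n) 1"

lemma profile_ge: "0 \<le> c \<Longrightarrow> c \<le> profile \<mu> s c j n"
  by (induction \<mu> s c j n rule: profile.induct) (auto intro: add_increasing2)

lemma profile_Suc_ge: "0 \<le> c \<Longrightarrow> profile \<mu> s c j n \<le> profile \<mu> s c j (Suc n)"
  using profile_ge[of c \<mu> s _ n] by (cases j) (auto intro!: mult_nonneg_nonneg intro: order_trans)

lemma profile_mono: "0 \<le> c \<Longrightarrow> m \<le> n \<Longrightarrow> profile \<mu> s c j m \<le> profile \<mu> s c j n"
  by (rule lift_Suc_mono_le[of "profile \<mu> s c j"]) (auto intro: profile_Suc_ge)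

definition profile_weight :: "nat pmf \<Rightarrow> (nat \<Rightarrow> nat) \<Rightarrow> real \<Rightarrow> nat \<Rightarrow> nat \<Rightarrow> real" where
  "profile_weight \<mu> s c j n = (case j of 0 \<Rightarrow> measure (measure_pmf \<mu>) {s n<..}
     | Suc i \<Rightarrow> profile \<mu> s c i n * pmf \<mu> (s n))"

lemma profile_Suc: "profile \<mu> s c j (Suc n) = profile \<mu> s c j n + profile_weight \<mu> s c j n"
  by (cases j) (simp_all add: profile_weight_def)

lemma profile_eq_sum: "profile \<mu> s c j n = c + (\<Sum>i<n. profile_weight \<mu> s c j i)"
  by (induction n) (simp_all add: profile_Suc)

lemma profile_weight_nonneg: "0 \<le> c \<Longrightarrow> 0 \<le> profile_weight \<mu> s c j n"
  using profile_Suc_ge[of c \<mu> s j n] by (simp add: profile_Suc)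

lemma tails_le: "tails a \<omega> n k \<le> a k + enat n"
proof (induction n)
  case (Suc n)
  have "tails a \<omega> (Suc n) k \<le> (a k + enat n) + 1"
    unfolding tails.simps using Suc by (intro add_mono) auto
  also have "\<dots> = a k + enat (Suc n)" by (cases "a k") (simp_all add: one_enat_def)
  finally show ?case .
qed simp

lemma tails_half_line_1: "tails (half_line 0) \<omega> n 1 = enat n"
proof (induction n)
  case 0
  show ?case by (simp add: half_line_def zero_enat_def)
next
  case (Suc n)
  have "tails (half_line 0) \<omega> n 0 = \<infinity>" by (simp add: tails_eq_infinity half_line_def)
  with Suc show ?case by (simp add: one_enat_def)
qed

text \<open>Since \<open>\<mu>\<close> is non-increasing and every tail to the right of the infinite bin is at most \<open>n\<close>, the
  probability of hitting the next bin is at least the content of the current bin times \<open>\<mu> n\<close>.\<close>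

lemma measure_gap_half_line_ge:
  assumes mono: "\<And>m n. 1 \<le> m \<Longrightarrow> m \<le> n \<Longrightarrow> pmf \<mu> n \<le> pmf \<mu> m" and k: "1 \<le> k"
  shows "visits (gap (half_line 0) k) \<omega> n * pmf \<mu> n \<le> measure (measure_pmf \<mu>) (gap (half_line 0) (k + 1) \<omega> n)"
proof -
  let ?a = "half_line 0"
  have a0: "?a k = 0" "?a (k + 1) = 0" using k by (auto simp: half_line_def)
  obtain t where t: "tails ?a \<omega> n k = enat t"
    using tails_eq_infinity[of ?a \<omega> n k] a0 by auto
  obtain t' where t': "tails ?a \<omega> n (k + 1) = enat t'"
    using tails_eq_infinity[of ?a \<omega> n "k + 1"] a0 by auto
  have eq: "t = t' + visits (gap ?a k) \<omega> n"
    using tails_balance[OF antimono_half_line, of 0 \<omega> n k] by (simp add: a0 t t')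
  have "t \<le> n" using tails_le[of ?a \<omega> n k] by (simp add: a0 t)
  have gap: "gap ?a (k + 1) \<omega> n = {Suc t'..t}"
    by (auto simp: gap_def t t' Suc_le_eq)
  have "visits (gap ?a k) \<omega> n * pmf \<mu> n = (\<Sum>x\<in>{Suc t'..t}. pmf \<mu> n)"
    using eq by simp
  also have "\<dots> \<le> (\<Sum>x\<in>{Suc t'..t}. pmf \<mu> x)"
    using \<open>t \<le> n\<close> by (intro sum_mono mono) auto
  also have "\<dots> = measure (measure_pmf \<mu>) {Suc t'..t}"
    by (simp add: measure_measure_pmf_finite)
  finally show ?thesis by (simp add: gap)
qed

text \<open>By induction on the bin: the rate of the bin at \<open>j + 2\<close> is at least the content of the bin at
  \<open>j + 1\<close> times \<open>\<mu> n\<close>, and that content is at least \<open>c * growth \<mu> j n\<close> with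
  probability tending to one.\<close>

lemma half_line_visits_lower_bound:
  assumes mono: "\<And>m n. 1 \<le> m \<Longrightarrow> m \<le> n \<Longrightarrow> pmf \<mu> n \<le> pmf \<mu> m"
    and div: "\<And>j. filterlim (growth \<mu> j) at_top sequentially"
  shows "\<exists>c>0. (\<lambda>n. measure (seqs \<mu>)
      {\<omega>. visits (gap (half_line 0) (1 + int j)) \<omega> n < c * growth \<mu> j n}) \<longlonglongrightarrow> 0"
proof -
  interpret S: prob_space "seqs \<mu>" by (rule prob_space_seqs)
  let ?v = "\<lambda>j. visits (gap (half_line 0) (1 + int j))"
  let ?w = "profile_weight \<mu> (\<lambda>n. n) 1"
  have step: "(\<lambda>n. measure (seqs \<mu>) {\<omega>. ?v j \<omega> n < c / 16 * growth \<mu> j n}) \<longlonglongrightarrow> 0"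
    if c: "0 < c" and lim: "(\<lambda>n. measure (seqs \<mu>)
      {\<omega>. measure (measure_pmf \<mu>) (gap (half_line 0) (1 + int j) \<omega> n) < c * ?w j n}) \<longlonglongrightarrow> 0" for j c
  proof -
    have "filterlim (\<lambda>n. - 1 + growth \<mu> j n) at_top sequentially"
      by (rule filterlim_tendsto_add_at_top[OF tendsto_const div])
    then have "filterlim (\<lambda>n. \<Sum>i<n. ?w j i) at_top sequentially"
      by (simp add: profile_eq_sum)
    from visits_lower_bound[OF adapted_gap profile_weight_nonneg c this lim]
    have lim': "(\<lambda>n. measure (seqs \<mu>) {\<omega>. ?v j \<omega> n < c / 8 * (\<Sum>i<n. ?w j i)}) \<longlonglongrightarrow> 0" by simp
    have "\<forall>\<^sub>F n in sequentially. 2 \<le> growth \<mu> j n"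
      using div[of j] by (simp add: filterlim_at_top)
    then have "\<forall>\<^sub>F n in sequentially. measure (seqs \<mu>) {\<omega>. ?v j \<omega> n < c / 16 * growth \<mu> j n} \<le>
        measure (seqs \<mu>) {\<omega>. ?v j \<omega> n < c / 8 * (\<Sum>i<n. ?w j i)}"
    proof eventually_elim
      case (elim n)
      have "c * growth \<mu> j n \<le> c * (2 * (\<Sum>i<n. ?w j i))"
        using elim c by (intro mult_left_mono) (auto simp: profile_eq_sum)
      then have "c / 16 * growth \<mu> j n \<le> c / 8 * (\<Sum>i<n. ?w j i)" by simp
      then have "?v j \<omega> n < c / 8 * (\<Sum>i<n. ?w j i)" if "?v j \<omega> n < c / 16 * growth \<mu> j n" for \<omega>
        using that by linarith
      then show ?case
        by (intro S.finite_measure_mono subsetI sets_adapted[OF adapted_compose[OF adapted_visits[OF adapted_gap]]]) simp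
    qed
    then show ?thesis
      by (rule tendsto_sandwich[OF _ _ tendsto_const lim', rotated]) (auto intro!: always_eventually)
  qed
  show ?thesis
  proof (induction j)
    case 0
    have "gap (half_line 0) 1 \<omega> n = {n<..}" for \<omega> n
      using tails_half_line_1[of \<omega> n] tails_eq_infinity[of "half_line 0" \<omega> n 0]
      by (auto simp: gap_def half_line_def)
    then show ?case
      by (intro exI[of _ "1 / 16"] conjI step) (auto simp: profile_weight_def)
  next
    case (Suc j)
    then obtain c where c: "0 < c" and
      lim: "(\<lambda>n. measure (seqs \<mu>) {\<omega>. ?v j \<omega> n < c * growth \<mu> j n}) \<longlonglongrightarrow> 0" by blast
    have "measure (seqs \<mu>) {\<omega>. measure (measure_pmf \<mu>) (gap (half_line 0) (1 + int (Suc j)) \<omega> n) < c * ?w (Suc j) n} \<le>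
        measure (seqs \<mu>) {\<omega>. ?v j \<omega> n < c * growth \<mu> j n}" for n
    proof (intro S.finite_measure_mono subsetI sets_adapted[OF adapted_compose[OF adapted_visits[OF adapted_gap]]] CollectI)
      fix \<omega> assume "\<omega> \<in> {\<omega>. measure (measure_pmf \<mu>) (gap (half_line 0) (1 + int (Suc j)) \<omega> n) < c * ?w (Suc j) n}"
      then have "?v j \<omega> n * pmf \<mu> n < c * growth \<mu> j n * pmf \<mu> n"
        using measure_gap_half_line_ge[OF mono, of "1 + int j" \<omega> n] by (simp add: profile_weight_def add_ac)
      then show "?v j \<omega> n < c * growth \<mu> j n"
        by (rule mult_right_less_imp_less) simp
    qed
    then have "(\<lambda>n. measure (seqs \<mu>) {\<omega>. measure (measure_pmf \<mu>) (gap (half_line 0) (1 + int (Suc j)) \<omega> n) < c * ?w (Suc j) n}) \<longlonglongrightarrow> 0"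
      by (intro tendsto_sandwich[OF _ _ tendsto_const lim] always_eventually allI) auto
    from step[OF c this] c show ?case by (intro exI[of _ "c / 16"]) simp
  qed
qed

lemma Inf_enat_in:
  fixes A :: "enat set" assumes "A \<noteq> {}" shows "Inf A \<in> A"
proof -
  from assms obtain x where "x \<in> A" by blast
  then have "(LEAST x. x \<in> A) \<in> A" by (rule LeastI)
  with assms show ?thesis by (simp add: Inf_enat_def)
qed

text \<open>Otherwise the content of the bin at the type \<open>d\<close> would exceed every bound in probability, although it stays finite
  almost surely.\<close>

lemma finite_type_growth_bounded:
  assumes pos: "set_pmf \<mu> \<subseteq> {1..}" and ft: "finite_type \<mu>"
    and mono: "\<And>m n. 1 \<le> m \<Longrightarrow> m \<le> n \<Longrightarrow> pmf \<mu> n \<le> pmf \<mu> m"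
  obtains j B where "\<And>n. growth \<mu> j n \<le> B"
proof (rule ccontr)
  assume "\<not> thesis"
  then have unb: "\<exists>n. B < growth \<mu> j n" for j B
    using that[of j B] by (auto simp: not_le[symmetric])
  interpret S: prob_space "seqs \<mu>" by (rule prob_space_seqs)
  have div: "filterlim (growth \<mu> j) at_top sequentially" for j
    unfolding filterlim_at_top eventually_sequentially
  proof
    fix B
    obtain N where "B < growth \<mu> j N" using unb by blast
    moreover have "growth \<mu> j N \<le> growth \<mu> j n" if "N \<le> n" for n
      using that by (intro profile_mono) simp_all
    ultimately show "\<exists>N. \<forall>n\<ge>N. B \<le> growth \<mu> j n" by (intro exI[of _ N]) force
  qed
  obtain d where d: "1 \<le> d" "of_type \<mu> (enat d)" using ft by (auto simp: finite_type_def)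
  define j where "j = d - 1"
  let ?v = "visits (gap (half_line 0) (1 + int j))"
  have ae: "AE \<omega> in seqs \<mu>. \<exists>B. \<forall>n. ?v \<omega> n \<le> B"
    using d(2)[unfolded of_type_def] AE_seqs_positive[OF pos]
  proof eventually_elim
    case (elim \<omega>)
    let ?S = "{k. 1 \<le> k \<and> ibm_limit hat_config \<omega> (int k) < \<infinity>}"
    have "?S \<noteq> {}"
    proof
      assume "?S = {}"
      then have "enat d = Inf (enat ` {})" by (rule subst) (rule elim(1))
      then show False by (simp add: top_enat_def)
    qed
    then have "Inf (enat ` ?S) \<in> enat ` ?S" by (intro Inf_enat_in) simp
    then obtain k where "Inf (enat ` ?S) = enat k" "k \<in> ?S" by (rule imageE)
    with elim(1) have "d \<in> ?S" by (metis enat.inject)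
    then have "ibm_limit hat_config \<omega> (int d) < \<infinity>" unfolding mem_Collect_eq by (rule conjunct2)
    then have "finite {n. \<omega> n \<in> gap (half_line 0) (int d) \<omega> n}"
      using ibm_limit_hat_infinite_iff[OF elim(2), of "int d"] d(1) by auto
    then show ?case using d(1) finite_visits_iff[of \<omega> "gap (half_line 0) (int d)"] by (simp add: j_def)
  qed
  let ?E = "\<lambda>B. {\<omega>. \<forall>n. ?v \<omega> n \<le> B}"
  have setE: "?E B \<in> sets (seqs \<mu>)" for B
  proof -
    have "(\<Inter>n. {\<omega>. ?v \<omega> n \<le> B}) \<in> sets (seqs \<mu>)"
      by (intro sets.countable_INT) (auto intro!: sets_adapted[OF adapted_compose[OF adapted_visits[OF adapted_gap]]])
    moreover have "(\<Inter>n. {\<omega>. ?v \<omega> n \<le> B}) = ?E B" by auto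
    ultimately show ?thesis by simp
  qed
  have "(\<lambda>B. measure (seqs \<mu>) (?E B)) \<longlonglongrightarrow> measure (seqs \<mu>) (\<Union>B. ?E B)"
    using setE by (intro S.finite_Lim_measure_incseq) (auto simp: incseq_def intro: order_trans)
  moreover have "measure (seqs \<mu>) (\<Union>B. ?E B) = 1"
    using ae setE by (intro S.prob_eq_1[THEN iffD2]) auto
  ultimately have "\<forall>\<^sub>F B in sequentially. 1 / 2 < measure (seqs \<mu>) (?E B)"
    by (intro order_tendstoD(1)) auto
  then obtain B where B: "1 / 2 < measure (seqs \<mu>) (?E B)"
    by (meson eventually_happens' sequentially_bot)
  obtain c where c: "0 < c" and lim: "(\<lambda>n. measure (seqs \<mu>) {\<omega>. ?v \<omega> n < c * growth \<mu> j n}) \<longlonglongrightarrow> 0"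
    using half_line_visits_lower_bound[OF mono div, of j] by blast
  have "\<forall>\<^sub>F n in sequentially. measure (seqs \<mu>) {\<omega>. ?v \<omega> n < c * growth \<mu> j n} < 1 / 2"
    using lim by (intro order_tendstoD(2)) auto
  moreover have "\<forall>\<^sub>F n in sequentially. real B / c < growth \<mu> j n"
    using div[of j] by (simp add: filterlim_at_top_dense)
  ultimately have "\<forall>\<^sub>F n in sequentially. False"
  proof eventually_elim
    case (elim n)
    from elim(2) c have "real B < c * growth \<mu> j n" by (simp add: field_simps)
    then have "measure (seqs \<mu>) (?E B) \<le> measure (seqs \<mu>) {\<omega>. ?v \<omega> n < c * growth \<mu> j n}"
      by (intro S.finite_measure_mono subsetI sets_adapted[OF adapted_compose[OF adapted_visits[OF adapted_gap]]])
        (auto intro: le_less_trans[rotated])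
    with elim(1) B show ?case by simp
  qed
  then show False by simp
qed

section \<open>Non-explosion for measures of finite type\<close>

text \<open>Slowing time down by a factor of two costs only a constant factor per level: the steps \<open>2 * n\<close> and
  \<open>2 * n + 1\<close> of the slow profile are compared with a single step of \<open>growth\<close>. The preceding level
  is taken at the end of these two steps, so each level delays the comparison by one step; the offset \<open>K\<close> makes up
  for the delay.\<close>

lemma profile_half_time_le:
  assumes mono: "\<And>m n. 1 \<le> m \<Longrightarrow> m \<le> n \<Longrightarrow> pmf \<mu> n \<le> pmf \<mu> m"
    and c: "1 \<le> c" and K: "j \<le> K"
  shows "profile \<mu> (\<lambda>n. n div 2 + K) c j (2 * n) \<le> c * 2 ^ (j + 1) * growth \<mu> j (n + j)"
  using K
proof (induction j arbitrary: n)
  case 0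
  show ?case
  proof (induction n)
    case (Suc n)
    have "measure (measure_pmf \<mu>) {n + K<..} \<le> measure (measure_pmf \<mu>) {n<..}"
      by (intro measure_pmf.finite_measure_mono) auto
    then have "measure (measure_pmf \<mu>) {n + K<..} \<le> c * measure (measure_pmf \<mu>) {n<..}"
      using c mult_right_mono[of 1 c "measure (measure_pmf \<mu>) {n<..}"] by simp
    with Suc show ?case by (simp add: algebra_simps)
  qed (use c in simp)
next
  case (Suc j)
  let ?P = "profile \<mu> (\<lambda>n. n div 2 + K) c"
  have jK: "Suc j \<le> K" by (rule Suc.prems)
  then have IH: "?P j (2 * n) \<le> c * 2 ^ (j + 1) * growth \<mu> j (n + j)" for n
    by (intro Suc.IH) simp
  show ?case
  proof (induction n)
    case 0
    have "1 * 1 \<le> 2 ^ (Suc j + 1) * growth \<mu> (Suc j) (0 + Suc j)"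
      using profile_ge[of 1 \<mu> "\<lambda>n. n" "Suc j" "0 + Suc j"] one_le_power[of "2 :: real" "Suc j + 1"]
      by (intro mult_mono) auto
    then have "c * 1 \<le> c * (2 ^ (Suc j + 1) * growth \<mu> (Suc j) (0 + Suc j))"
      using c by (intro mult_left_mono) auto
    then show ?case by (simp add: mult.assoc)
  next
    case (Suc n)
    have c0: "0 \<le> c" using c by simp
    have "?P j (2 * n) \<le> ?P j (2 * Suc n)" "?P j (2 * n + 1) \<le> ?P j (2 * Suc n)"
      using c by (auto intro!: profile_mono)
    then have "?P j (2 * n) + ?P j (2 * n + 1) \<le> 2 * (c * 2 ^ (j + 1) * growth \<mu> j (Suc n + j))"
      using IH[of "Suc n"] by linarith
    moreover have "pmf \<mu> (n + K) \<le> pmf \<mu> (n + Suc j)"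
      using jK by (intro mono) auto
    moreover have "0 \<le> growth \<mu> j (Suc n + j)"
      using profile_ge[of 1 \<mu> "\<lambda>n. n" j "Suc n + j"] by simp
    ultimately have "(?P j (2 * n) + ?P j (2 * n + 1)) * pmf \<mu> (n + K) \<le>
        2 * (c * 2 ^ (j + 1) * growth \<mu> j (Suc n + j)) * pmf \<mu> (n + Suc j)"
      using c0 by (intro mult_mono) auto
    with Suc.IH show ?case by (simp add: algebra_simps)
  qed
qed

text \<open>The event that the tails of the bins from \<open>p + 1\<close> to \<open>p + 1 + K\<close> have grown linearly at all times
  from \<open>n0\<close> to \<open>n\<close>. It is restricted to times up to \<open>n\<close> so as to be determined by the first
  \<open>n\<close> moves.\<close>

definition linear_tails :: "(int \<Rightarrow> enat) \<Rightarrow> int \<Rightarrow> nat \<Rightarrow> nat \<Rightarrow> (nat \<Rightarrow> nat) \<Rightarrow> nat \<Rightarrow> bool" where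
  "linear_tails a p K n0 \<omega> n \<longleftrightarrow>
    (\<forall>i. n0 \<le> i \<and> i \<le> n \<longrightarrow> (\<forall>j\<le>K. enat (i div 2 + K) \<le> tails a \<omega> i (p + 1 + int j)))"

lemma linear_tailsD:
  "linear_tails a p K n0 \<omega> n \<Longrightarrow> n0 \<le> n \<Longrightarrow> j \<le> K \<Longrightarrow>
    enat (n div 2 + K) \<le> tails a \<omega> n (p + 1 + int j)"
  by (simp add: linear_tails_def)

lemma adapted_linear_tails: "adapted n (\<lambda>\<omega>. linear_tails a p K n0 \<omega> n)"
  unfolding adapted_def
proof (intro allI impI)
  fix \<omega> \<omega>' :: "nat \<Rightarrow> nat" assume eq: "\<forall>i<n. \<omega> i = \<omega>' i"
  have "tails a \<omega> i = tails a \<omega>' i" if "i \<le> n" for i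
    using eq that by (intro adaptedD[OF adapted_tails]) simp
  then show "linear_tails a p K n0 \<omega> n = linear_tails a p K n0 \<omega>' n"
    by (simp add: linear_tails_def)
qed

lemma measure_gap_le_visits:
  assumes mono: "\<And>m n. 1 \<le> m \<Longrightarrow> m \<le> n \<Longrightarrow> pmf \<mu> n \<le> pmf \<mu> m"
    and am: "antimono a" and fin: "a k \<le> enat C" and t: "enat s \<le> tails a \<omega> n (k + 1)"  and s: "1 \<le> s"
  shows "measure (measure_pmf \<mu>) (gap a (k + 1) \<omega> n) \<le> (C + visits (gap a k) \<omega> n) * pmf \<mu> s"
proof -
  obtain ak where ak: "a k = enat ak" "ak \<le> C" using fin by (cases "a k") auto
  obtain ak' where ak': "a (k + 1) = enat ak'"
    using antimonoD[OF am, of k "k + 1"] ak by (auto dest: enat_ile)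
  obtain u where u: "tails a \<omega> n k = enat u" using tails_eq_infinity[of a \<omega> n k] ak by auto
  obtain u' where u': "tails a \<omega> n (k + 1) = enat u'" using tails_eq_infinity[of a \<omega> n "k + 1"] ak' by auto
  have "u \<le> u' + (C + visits (gap a k) \<omega> n)"
  proof -
    have "u + ak' = u' + ak + visits (gap a k) \<omega> n"
      using tails_balance[OF am, of \<omega> n k] by (simp add: ak ak' u u')
    then show ?thesis using ak(2) by linarith
  qed
  then have "gap a (k + 1) \<omega> n \<subseteq> {u'<..u' + (C + visits (gap a k) \<omega> n)}"
    by (auto simp: gap_def u u')
  then have "measure (measure_pmf \<mu>) (gap a (k + 1) \<omega> n) \<le>
      measure (measure_pmf \<mu>) {u'<..u' + (C + visits (gap a k) \<omega> n)}"
    by (intro measure_pmf.finite_measure_mono) auto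
  also have "\<dots> = (\<Sum>x\<in>{u'<..u' + (C + visits (gap a k) \<omega> n)}. pmf \<mu> x)"
    by (simp add: measure_measure_pmf_finite)
  also have "\<dots> \<le> (\<Sum>x\<in>{u'<..u' + (C + visits (gap a k) \<omega> n)}. pmf \<mu> s)"
    using t s u' by (intro sum_mono mono) auto
  finally show ?thesis by simp
qed

text \<open>On the event that the tails have grown linearly, the gap after a bin has probability at most the content of the bin times
  \<open>\<mu> (n div 2 + K)\<close>. Being linear in the content, this bound passes to expectations and gives the recursion
  of \<open>profile\<close>. The content is represented by \<open>C\<close> plus the number of balls received, where
  \<open>C\<close> bounds the initial content.\<close>

lemma expected_visits_le_profile:
  assumes mono: "\<And>m n. 1 \<le> m \<Longrightarrow> m \<le> n \<Longrightarrow> pmf \<mu> n \<le> pmf \<mu> m"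
    and am: "antimono a" and fin: "a (p + 1) \<le> enat C" and j: "j \<le> K" and K: "1 \<le> K" and n: "n0 \<le> n"
  shows "(\<integral>\<^sup>+\<omega>. ennreal (C + visits (gap a (p + 1 + int j)) \<omega> n) *
      indicator {\<omega>. linear_tails a p K n0 \<omega> n} \<omega> \<partial>seqs \<mu>) \<le> ennreal (profile \<mu> (\<lambda>n. n div 2 + K) (C + n0) j n)"
    (is "?u j n \<le> ennreal (?P j n)")
    and "emeasure (seqs \<mu>) {\<omega>. linear_tails a p K n0 \<omega> n \<and> \<omega> n \<in> gap a (p + 1 + int j) \<omega> n} \<le>
      ennreal (profile_weight \<mu> (\<lambda>n. n div 2 + K) (C + n0) j n)"
    (is "?e j n \<le> ennreal (?w j n)")
proof -
  interpret S: prob_space "seqs \<mu>" by (rule prob_space_seqs)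
  let ?L = "\<lambda>n. {\<omega>. linear_tails a p K n0 \<omega> n}"
  let ?g = "\<lambda>j. gap a (p + 1 + int j)"
  let ?A = "\<lambda>j n. {\<omega>. linear_tails a p K n0 \<omega> n \<and> \<omega> n \<in> ?g j \<omega> n}"
  have P0: "0 \<le> ?P j n" for j n
    using profile_ge[of "real (C + n0)" \<mu> "\<lambda>n. n div 2 + K" j n] by simp
  have w0: "0 \<le> ?w j n" for j n
    by (rule profile_weight_nonneg) simp
  have setL: "?L n \<in> sets (seqs \<mu>)" for n by (rule sets_adapted[OF adapted_linear_tails])
  have setA: "?A j n \<in> sets (seqs \<mu>)" for j n
    by (rule sets_adapted[of "Suc n"], rule adapted_compose2[OF adapted_mono[OF adapted_linear_tails]
          adapted_compose2[OF adapted_coordinate[of n] adapted_mono[OF adapted_gap]]]) auto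
  have meas: "(\<lambda>\<omega>. ennreal (C + visits (?g j) \<omega> n) * indicator (?L m) \<omega>) \<in> borel_measurable (seqs \<mu>)" for j m n
  proof -
    have "(\<lambda>\<omega>. ennreal (C + visits (?g j) \<omega> n)) \<in> borel_measurable (seqs \<mu>)"
      by (rule measurable_adapted[OF adapted_compose[OF adapted_visits[OF adapted_gap]]]) simp
    then show ?thesis using setL by (intro borel_measurable_times_ennreal borel_measurable_indicator) auto
  qed
  have adL: "adapted n (\<lambda>\<omega>. indicator (?L n) \<omega> :: ennreal)" for n
    using adapted_compose[OF adapted_linear_tails[of n a p K n0], of "of_bool :: bool \<Rightarrow> ennreal"]
    by (simp add: indicator_def)
  have Ae: "?e j n = (\<integral>\<^sup>+\<omega>. indicator (?L n) \<omega> * emeasure (measure_pmf \<mu>) (?g j \<omega> n) \<partial>seqs \<mu>)" for j n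
  proof -
    have "?e j n = (\<integral>\<^sup>+\<omega>. indicator (?A j n) \<omega> \<partial>seqs \<mu>)"
      using setA by simp
    also have "\<dots> = (\<integral>\<^sup>+\<omega>. indicator (?L n) \<omega> * indicator (?g j \<omega> n) (\<omega> n) \<partial>seqs \<mu>)"
      by (intro nn_integral_cong) (auto simp: indicator_def)
    also have "\<dots> = (\<integral>\<^sup>+\<omega>. indicator (?L n) \<omega> * emeasure (measure_pmf \<mu>) (?g j \<omega> n) \<partial>seqs \<mu>)"
      by (rule nn_integral_fresh_indicator[OF adapted_gap adL])
    finally show ?thesis .
  qed
  have e_step: "?e j n \<le> ennreal (?w j n)" if "n0 \<le> n" "j \<le> K" "\<And>i. j = Suc i \<Longrightarrow> ?u i n \<le> ennreal (?P i n)" for j n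
  proof (cases j)
    case 0
    have "?e 0 n \<le> (\<integral>\<^sup>+\<omega>. ennreal (?w 0 n) \<partial>seqs \<mu>)"
      unfolding Ae
    proof (rule nn_integral_mono)
      fix \<omega>
      show "indicator (?L n) \<omega> * emeasure (measure_pmf \<mu>) (?g 0 \<omega> n) \<le> ennreal (?w 0 n)"
      proof (cases "\<omega> \<in> ?L n")
        case True
        then have "enat (n div 2 + K) \<le> tails a \<omega> n (p + 1)"
          using linear_tailsD[of a p K n0 \<omega> n 0] \<open>n0 \<le> n\<close> by simp
        then have "?g 0 \<omega> n \<subseteq> {n div 2 + K<..}"
          by (auto simp: gap_def dest!: order.strict_trans1)
        then have "measure (measure_pmf \<mu>) (?g 0 \<omega> n) \<le> ?w 0 n"
          unfolding profile_weight_def by (simp add: measure_pmf.finite_measure_mono)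
        then show ?thesis using True by (simp add: measure_pmf.emeasure_eq_measure ennreal_leI)
      qed simp
    qed
    also have "\<dots> = ennreal (?w 0 n)" using S.emeasure_space_1 by simp
    finally show ?thesis using 0 by simp
  next
    case (Suc i)
    let ?q = "pmf \<mu> (n div 2 + K)"
    have "?e j n \<le> (\<integral>\<^sup>+\<omega>. ennreal (C + visits (?g i) \<omega> n) * indicator (?L n) \<omega> * ennreal ?q \<partial>seqs \<mu>)"
      unfolding Ae
    proof (rule nn_integral_mono)
      fix \<omega>
      show "indicator (?L n) \<omega> * emeasure (measure_pmf \<mu>) (?g j \<omega> n) \<le>
          ennreal (C + visits (?g i) \<omega> n) * indicator (?L n) \<omega> * ennreal ?q"
      proof (cases "\<omega> \<in> ?L n")
        case True
        then have t: "enat (n div 2 + K) \<le> tails a \<omega> n (p + 1 + int i + 1)"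
          using linear_tailsD[of a p K n0 \<omega> n j] \<open>n0 \<le> n\<close> \<open>j \<le> K\<close> Suc by (simp add: add_ac)
        have "a (p + 1 + int i) \<le> enat C"
          using antimonoD[OF am, of "p + 1" "p + 1 + int i"] fin by (auto intro: order_trans)
        from measure_gap_le_visits[OF mono am this t]
        have "measure (measure_pmf \<mu>) (?g j \<omega> n) \<le> (C + visits (?g i) \<omega> n) * ?q"
          using K Suc by (simp add: add_ac)
        then have "ennreal (measure (measure_pmf \<mu>) (?g j \<omega> n)) \<le> ennreal ((C + visits (?g i) \<omega> n) * ?q)"
          by (rule ennreal_leI)
        also have "\<dots> = ennreal (C + visits (?g i) \<omega> n) * ennreal ?q"
          by (rule ennreal_mult) auto
        finally show ?thesis using True
          by (simp add: measure_pmf.emeasure_eq_measure del: ennreal_plus)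
      qed simp
    qed
    also have "\<dots> = ?u i n * ennreal ?q"
      by (rule nn_integral_multc[OF meas])
    also have "\<dots> \<le> ennreal (?P i n) * ennreal ?q"
      using that(3)[OF Suc] by (rule mult_right_mono) simp
    also have "\<dots> = ennreal (?w j n)"
      using P0 by (simp add: Suc profile_weight_def ennreal_mult)
    finally show ?thesis .
  qed
  have u: "?u j n \<le> ennreal (?P j n)" if "j \<le> K" "n0 \<le> n" for j n
    using that
  proof (induction j arbitrary: n rule: less_induct)
    case (less j)
    show ?case
      using \<open>n0 \<le> n\<close>
    proof (induction n rule: dec_induct)
      case base
      have "?u j n0 \<le> (\<integral>\<^sup>+\<omega>. ennreal (C + n0) \<partial>seqs \<mu>)"
        using visits_le by (intro nn_integral_mono) (auto simp: indicator_def intro!: ennreal_leI)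
      also have "\<dots> = ennreal (C + n0)" using S.emeasure_space_1 by simp
      also have "\<dots> \<le> ennreal (?P j n0)"
        by (intro ennreal_leI profile_ge) simp
      finally show ?case .
    next
      case (step n)
      have "?u j (Suc n) \<le> (\<integral>\<^sup>+\<omega>. ennreal (C + visits (?g j) \<omega> n) * indicator (?L n) \<omega> + indicator (?A j n) \<omega> \<partial>seqs \<mu>)"
      proof (rule nn_integral_mono)
        fix \<omega>
        have "linear_tails a p K n0 \<omega> (Suc n) \<Longrightarrow> linear_tails a p K n0 \<omega> n"
          by (auto simp: linear_tails_def)
        then show "ennreal (C + visits (?g j) \<omega> (Suc n)) * indicator (?L (Suc n)) \<omega> \<le>
            ennreal (C + visits (?g j) \<omega> n) * indicator (?L n) \<omega> + indicator (?A j n) \<omega>"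
          by (auto simp: visits_Suc indicator_def)
      qed
      also have "\<dots> = ?u j n + ?e j n"
        using meas setA by (subst nn_integral_add) auto
      also have "\<dots> \<le> ennreal (?P j n) + ennreal (?w j n)"
      proof (intro add_mono e_step)
        fix i assume "j = Suc i"
        then show "?u i n \<le> ennreal (?P i n)" using less.IH[of i n] less.prems step by simp
      qed (use step less.prems in auto)
      also have "\<dots> = ennreal (?P j (Suc n))"
        using P0 w0 by (simp add: profile_Suc ennreal_plus[symmetric] del: ennreal_plus)
      finally show ?case .
    qed
  qed
  show "?u j n \<le> ennreal (?P j n)" by (rule u[OF j n])
  show "?e j n \<le> ennreal (?w j n)"
    by (rule e_step[OF n j]) (use u j n in auto)
qed

lemma AE_finite_gap_linear_tails:
  assumes mono: "\<And>m n. 1 \<le> m \<Longrightarrow> m \<le> n \<Longrightarrow> pmf \<mu> n \<le> pmf \<mu> m"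
    and am: "antimono a" and fin: "a (p + 1) \<noteq> \<infinity>" and bd: "\<And>n. growth \<mu> j n \<le> B"
  shows "AE \<omega> in seqs \<mu>. (\<forall>n. linear_tails a p (Suc j) n0 \<omega> n) \<longrightarrow>
    finite {n. \<omega> n \<in> gap a (p + 1 + int j) \<omega> n}"
proof -
  interpret S: prob_space "seqs \<mu>" by (rule prob_space_seqs)
  let ?g = "gap a (p + 1 + int j)" and ?K = "Suc j"
  let ?A = "\<lambda>n. {\<omega>. linear_tails a p ?K n0 \<omega> n \<and> \<omega> n \<in> ?g \<omega> n}"
  obtain C where C: "a (p + 1) = enat C" using fin by auto
  define c where "c = real (Suc C + n0)"
  let ?P = "profile \<mu> (\<lambda>n. n div 2 + ?K) c j"
  let ?w = "profile_weight \<mu> (\<lambda>n. n div 2 + ?K) c j"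
  have c: "1 \<le> c" by (simp add: c_def)
  have P: "?P n \<le> c * 2 ^ (j + 1) * B" for n
  proof -
    have "?P n \<le> ?P (2 * n)" using c by (intro profile_mono) auto
    also have "\<dots> \<le> c * 2 ^ (j + 1) * growth \<mu> j (n + j)"
      by (rule profile_half_time_le[OF mono c]) auto
    also have "\<dots> \<le> c * 2 ^ (j + 1) * B"
      using c bd by (intro mult_left_mono) auto
    finally show ?thesis .
  qed
  have w0: "0 \<le> ?w n" for n using c by (intro profile_weight_nonneg) simp
  have setA: "?A n \<in> sets (seqs \<mu>)" for n
    by (rule sets_adapted[of "Suc n"], rule adapted_compose2[OF adapted_mono[OF adapted_linear_tails]
          adapted_compose2[OF adapted_coordinate[of n] adapted_mono[OF adapted_gap]]]) auto
  have le: "measure (seqs \<mu>) (?A n) \<le> ?w n" if "n0 \<le> n" for n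
    using expected_visits_le_profile(2)[OF mono am, of p "Suc C" j ?K n0 n] that C w0[of n]
    by (simp add: S.emeasure_eq_measure c_def)
  have "summable ?w"
  proof (rule summableI_nonneg_bounded)
    show "(\<Sum>i<n. ?w i) \<le> c * 2 ^ (j + 1) * B" for n
      using P[of n] c by (simp add: profile_eq_sum)
  qed (rule w0)
  then have "summable (\<lambda>n. measure (seqs \<mu>) (?A n))"
    by (rule summable_comparison_test'[where N=n0]) (use le in simp)
  then have "AE \<omega> in seqs \<mu>. eventually (\<lambda>n. \<omega> \<in> space (seqs \<mu>) - ?A n) sequentially"
    by (intro borel_cantelli_AE1 setA) (auto simp: S.emeasure_eq_measure)
  then show ?thesis
  proof eventually_elim
    case (elim \<omega>)
    show ?case
    proof
      assume L: "\<forall>n. linear_tails a p ?K n0 \<omega> n"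
      from elim obtain N where "\<And>n. N \<le> n \<Longrightarrow> \<omega> \<notin> ?A n" by (auto simp: eventually_sequentially)
      with L have "{n. \<omega> n \<in> ?g \<omega> n} \<subseteq> {..<N}" by (auto simp: not_le[symmetric])
      then show "finite {n. \<omega> n \<in> ?g \<omega> n}" by (rule finite_subset) simp
    qed
  qed
qed

lemma AE_finite_gap_of_large_tail:
  assumes mono: "\<And>m n. 1 \<le> m \<Longrightarrow> m \<le> n \<Longrightarrow> pmf \<mu> n \<le> pmf \<mu> m"
    and am: "antimono a" and fin: "a (p + 1) \<noteq> \<infinity>" and bd: "\<And>n. growth \<mu> j n \<le> B"
    and m: "7 / 8 \<le> measure (measure_pmf \<mu>) {..m}" and large: "enat m \<le> a p"
  shows "AE \<omega> in seqs \<mu>. finite {n. \<omega> n \<in> gap a (p + 1 + int j) \<omega> n}"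
proof -
  have "AE \<omega> in seqs \<mu>. \<forall>n0. (\<forall>n. linear_tails a p (Suc j) n0 \<omega> n) \<longrightarrow>
      finite {n. \<omega> n \<in> gap a (p + 1 + int j) \<omega> n}"
    unfolding AE_all_countable using AE_finite_gap_linear_tails[OF mono am fin bd] by blast
  with AE_mostly_below[OF m] show ?thesis
  proof eventually_elim
    case (elim \<omega>)
    have "\<forall>\<^sub>F i in sequentially. \<forall>k\<in>{..Suc j}. enat (i div 2 + Suc j) \<le> tails a \<omega> i (p + 1 + int k)"
      by (intro eventually_ball_finite ballI tails_growth[where a=a and p=p, OF elim(1) large]) auto
    then obtain n0 where "\<And>i. n0 \<le> i \<Longrightarrow> \<forall>k\<in>{..Suc j}. enat (i div 2 + Suc j) \<le> tails a \<omega> i (p + 1 + int k)"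
      by (auto simp: eventually_sequentially)
    then have "\<forall>n. linear_tails a p (Suc j) n0 \<omega> n" by (auto simp: linear_tails_def)
    with elim(2) show ?case by blast
  qed
qed

lemma gap_empty_of_constant_tail:
  assumes "\<And>k. k \<le> q \<Longrightarrow> a k = a q"
  shows "gap a q \<omega> n = {}"
proof -
  have eq: "tails a \<omega> n k = tails a \<omega> n q" if "k \<le> q" for k
    using that
  proof (induction n arbitrary: k)
    case 0
    show ?case using assms[OF 0] by simp
  next
    case (Suc n)
    have "tails a \<omega> n k = tails a \<omega> n q" "tails a \<omega> n (k - 1) = tails a \<omega> n q"
      "tails a \<omega> n (q - 1) = tails a \<omega> n q"
      by (rule Suc.IH, use Suc.prems in simp)+
    then show ?case by (simp only: tails.simps)
  qed
  have "tails a \<omega> n (q - 1) = tails a \<omega> n q" by (rule eq) simp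
  then show ?thesis by (auto simp: gap_def)
qed

text \<open>This is the case of finitely many balls: no bin up to the leftmost ball ever receives a ball.\<close>

lemma bounded_tail_eventually_constant:
  assumes am: "antimono a" and bd: "\<And>k. k \<le> r \<Longrightarrow> a k < enat m"
  obtains q where "q \<le> r" "\<And>k. k \<le> q \<Longrightarrow> a k = a q"
proof -
  let ?S = "a ` {..r}"
  have "?S \<subseteq> enat ` {..<m}"
  proof
    fix x assume "x \<in> ?S"
    then have "x < enat m" using bd by auto
    then show "x \<in> enat ` {..<m}" by (cases x) auto
  qed
  then have fin: "finite ?S" by (rule finite_subset) simp
  have "Max ?S \<in> ?S" using fin by (intro Max_in) auto
  then obtain q where q: "q \<le> r" "Max ?S = a q" by auto
  have "a k = a q" if "k \<le> q" for k
  proof (rule antisym)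
    show "a k \<le> a q" unfolding q(2)[symmetric] using fin that q(1) by (intro Max_ge) auto
    show "a q \<le> a k" using antimonoD[OF am that] .
  qed
  with q(1) that show ?thesis by blast
qed

text \<open>Every bin \<open>k\<close> has a bin to its left that stays finite: either one at a fixed distance from a bin with a large tail
  or, if no tail is large, one to the left of all balls. Finiteness then spreads to the right.\<close>

lemma AE_finite_gap:
  assumes pos: "set_pmf \<mu> \<subseteq> {1..}" and ft: "finite_type \<mu>"
    and mono: "\<And>m n. 1 \<le> m \<Longrightarrow> m \<le> n \<Longrightarrow> pmf \<mu> n \<le> pmf \<mu> m"
    and am: "antimono a" and fin: "\<And>k. a k \<noteq> \<infinity>"
  shows "AE \<omega> in seqs \<mu>. finite {n. \<omega> n \<in> gap a k \<omega> n}"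
proof -
  obtain j B where bd: "\<And>n. growth \<mu> j n \<le> B"
    using finite_type_growth_bounded[OF pos ft mono] by blast
  obtain m where m: "7 / 8 \<le> measure (measure_pmf \<mu>) {..m}" by (rule exists_typical_bound)
  then have m0: "0 < measure (measure_pmf \<mu>) {..m}" by linarith
  have "\<exists>q\<le>k. AE \<omega> in seqs \<mu>. finite {n. \<omega> n \<in> gap a q \<omega> n}"
  proof (cases "\<exists>p\<le>k - 1 - int j. enat m \<le> a p")
    case True
    then obtain p where p: "p \<le> k - 1 - int j" "enat m \<le> a p" by blast
    then show ?thesis
      using AE_finite_gap_of_large_tail[OF mono am fin bd m p(2)] by (intro exI[of _ "p + 1 + int j"]) auto
  next
    case False
    then have "a p < enat m" if "p \<le> k - 1 - int j" for p using that not_le by blast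
    then obtain q where q: "q \<le> k - 1 - int j" "\<And>p. p \<le> q \<Longrightarrow> a p = a q"
      by (rule bounded_tail_eventually_constant[OF am]) auto
    have "gap a q \<omega> n = {}" for \<omega> n using q(2) by (rule gap_empty_of_constant_tail)
    then have "AE \<omega> in seqs \<mu>. finite {n. \<omega> n \<in> gap a q \<omega> n}" by simp
    moreover have "q \<le> k" using q(1) by simp
    ultimately show ?thesis by blast
  qed
  then obtain q where q: "q \<le> k" "AE \<omega> in seqs \<mu>. finite {n. \<omega> n \<in> gap a q \<omega> n}" by blast
  from q(2) AE_finite_windows[OF am m0] show ?thesis
  proof eventually_elim
    case (elim \<omega>)
    show ?case by (rule finite_gap_later[OF am elim(2) fin elim(1) q(1)])
  qed
qed

lemma finite_type_no_explosion:
  assumes pos: "set_pmf \<mu> \<subseteq> {1..}" and ft: "finite_type \<mu>"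
    and mono: "\<And>m n. 1 \<le> m \<Longrightarrow> m \<le> n \<Longrightarrow> pmf \<mu> n \<le> pmf \<mu> m"
    and X0: "X0 \<in> configs" and lf: "locally_finite X0"
  shows "AE \<omega> in seqs \<mu>. ibm_limit X0 \<omega> k < \<infinity>"
proof -
  obtain R where R: "\<forall>j>R. X0 j = 0" by (rule configs_right_bounded[OF X0])
  have Xfin: "X0 j \<noteq> \<infinity>" for j using lf by (simp add: locally_finite_def)
  have "sum X0 A \<noteq> \<infinity>" if "finite A" for A
    using that by (induction A) (simp_all add: Xfin plus_eq_infty_iff_enat del: not_infinity_eq)
  then have fin: "tail X0 k \<noteq> \<infinity>" for k
    unfolding tail_eq_sum[OF R] by simp
  have "AE \<omega> in seqs \<mu>. finite {n. \<omega> n \<in> gap (tail X0) k \<omega> n}"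
    by (rule AE_finite_gap[OF pos ft mono antimono_tail[OF R] fin])
  with AE_seqs_positive[OF pos] show ?thesis
  proof eventually_elim
    case (elim \<omega>)
    then have "ibm_limit X0 \<omega> k \<noteq> \<infinity>"
      using ibm_limit_infinite_iff[OF X0 elim(1), of k] Xfin by simp
    then show ?case by simp
  qed
qed

theorem theorem1p9:
  fixes \<mu> :: "nat pmf"
  assumes "set_pmf \<mu> \<subseteq> {1..}"
  shows "(finite_type \<mu> \<and> (\<forall>m n. 1 \<le> m \<and> m \<le> n \<longrightarrow> pmf \<mu> n \<le> pmf \<mu> m) \<longrightarrow>
           (\<forall>X0\<in>configs. locally_finite X0 \<longrightarrow>
              (\<forall>(M :: 'a measure) \<xi>. iid_with_law M \<xi> \<mu> \<longrightarrow>
                 (\<forall>k. AE \<omega> in M. ibm_limit X0 (\<lambda>n. \<xi> n \<omega>) k < \<infinity>)))) \<and>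
         (infinite_type \<mu> \<longrightarrow>
           (\<exists>X0\<in>configs. locally_finite X0 \<and>
              (\<forall>(M :: 'a measure) \<xi>. iid_with_law M \<xi> \<mu> \<longrightarrow>
                 (\<forall>k. AE \<omega> in M. ibm_limit X0 (\<lambda>n. \<xi> n \<omega>) k = \<infinity>))))"
proof (intro conjI impI ballI allI)
  fix X0 :: config and M :: "'a measure" and \<xi> k
  assume ft: "finite_type \<mu> \<and> (\<forall>m n. 1 \<le> m \<and> m \<le> n \<longrightarrow> pmf \<mu> n \<le> pmf \<mu> m)"
    and X0: "X0 \<in> configs" and lf: "locally_finite X0" and iid: "iid_with_law M \<xi> \<mu>"
  have "AE \<omega> in seqs \<mu>. ibm_limit X0 \<omega> k < \<infinity>"
    using ft by (intro finite_type_no_explosion[OF assms _ _ X0 lf]) simp_all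
  then show "AE \<omega> in M. ibm_limit X0 (\<lambda>n. \<xi> n \<omega>) k < \<infinity>" by (rule AE_iid[OF iid])
next
  assume "infinite_type \<mu>"
  then obtain X0 where X0: "X0 \<in> configs" "locally_finite X0"
    and ae: "AE \<omega> in seqs \<mu>. \<forall>k. ibm_limit X0 \<omega> k = \<infinity>"
    by (rule infinite_type_explosion[OF assms])
  have "AE \<omega> in M. ibm_limit X0 (\<lambda>n. \<xi> n \<omega>) k = \<infinity>"
    if "iid_with_law M \<xi> \<mu>" for M :: "'a measure" and \<xi> k
    by (rule AE_mp[OF AE_iid[OF that ae]]) simp
  with X0 show "\<exists>X0\<in>configs. locally_finite X0 \<and>
      (\<forall>(M :: 'a measure) \<xi>. iid_with_law M \<xi> \<mu> \<longrightarrow>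
        (\<forall>k. AE \<omega> in M. ibm_limit X0 (\<lambda>n. \<xi> n \<omega>) k = \<infinity>))"
    by (intro bexI[of _ X0] conjI allI impI)
qed

end
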